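(* Let $\sigma>0$ and let $X_{1,1},X_{1,2},X_{2,1},X_{2,2}$ be independent random variables, each with the Rayleigh density $f(x)=\frac{2x}{\sigma}\exp\left(-\frac{x^2}{\sigma}\right)$, $x\ge 0$. Let $\tilde X$ be the first addend of the larger of the two sums $X_{1,1}+X_{1,2}$ and $X_{2,1}+X_{2,2}$. Then $\tilde X$ has density $$f_{\tilde X}(x)=\frac{4x}{\sigma}\exp\left(-\frac{x^2}{\sigma}\right)h(x),\qquad x\ge 0,$$ where $$h(x)=\frac12-\frac12\mathcal I(x)+\sqrt{\frac{\pi}{2\sigma}}\,\mathcal J(x),$$ $$\mathcal I(x)=\frac12\exp\left(-\frac{x^2}{\sigma}\right)-x\exp\left(-\frac{x^2}{2\sigma}\right)\sqrt{\frac{\pi}{2\sigma}}\,Q\left(\frac{x}{\sqrt\sigma}\right),$$ $$\mathcal J(x)=\sqrt{\frac{\sigma}{2\pi}}-\frac{4x}{9}\exp\left(-\frac{x^2}{2\sigma}\right)+\frac{23x}{18}\exp\left(-\frac{x^2}{2\sigma}\right)Q\left(\frac{x}{\sqrt\sigma}\right)-\frac56\sqrt{\frac{\sigma}{2\pi}}\exp\left(-\frac{x^2}{\sigma}\right)+\sqrt{\frac{2\sigma}{3\pi}}\left(\frac{4x^2}{9\sigma}-\frac23\right)\exp\left(-\frac{x^2}{3\sigma}\right)\phi(x),$$ $$\phi(x)=\pi Q\left(\frac{x}{\sqrt{3\sigma}}\right)-2\int_0^{\pi/6}\exp\left(-\frac{x^2}{6\sigma\sin^2\theta}\right)d\thet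a.$$
   Context: The first addend of the larger sum is $\tilde X:=X_{J,1}$, where $J\in\{1,2\}$ is the almost surely unique index maximizing $X_{j,1}+X_{j,2}$. $Q(x)=\frac{1}{\sqrt{2\pi}}\int_x^\infty\exp\left(-\frac{u^2}{2}\right)du$ is the Gaussian Q-function. *)

theory Defs
  imports "HOL-Probability.Probability"
begin

definition rayleigh_density :: "real \<Rightarrow> real \<Rightarrow> real" where
  "rayleigh_density \<sigma> x = (if 0 \<le> x then 2 * x / \<sigma> * exp (- (x\<^sup>2 / \<sigma>)) else 0)"

definition gauss_Q :: "real \<Rightarrow> real" where
  "gauss_Q x = 1 / sqrt (2 * pi) * (LBINT u:{x..}. exp (- (u\<^sup>2 / 2)))"

(* At \<theta> = 0 the integrand is only the junk value exp 0 (division by zero); this endpoint is a null set. *)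
definition phi_fun :: "real \<Rightarrow> real \<Rightarrow> real" where
  "phi_fun \<sigma> x =
     pi * gauss_Q (x / sqrt (3 * \<sigma>))
     - 2 * (LBINT \<theta>:{0..pi / 6}. exp (- (x\<^sup>2 / (6 * \<sigma> * (sin \<theta>)\<^sup>2))))"

definition I_fun :: "real \<Rightarrow> real \<Rightarrow> real" where
  "I_fun \<sigma> x =
     1 / 2 * exp (- (x\<^sup>2 / \<sigma>))
     - x * exp (- (x\<^sup>2 / (2 * \<sigma>))) * sqrt (pi / (2 * \<sigma>)) * gauss_Q (x / sqrt \<sigma>)"

definition J_fun :: "real \<Rightarrow> real \<Rightarrow> real" where
  "J_fun \<sigma> x =
     sqrt (\<sigma> / (2 * pi))
     - 4 * x / 9 * exp (- (x\<^sup>2 / (2 * \<sigma>)))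
     + 23 * x / 18 * exp (- (x\<^sup>2 / (2 * \<sigma>))) * gauss_Q (x / sqrt \<sigma>)
     - 5 / 6 * sqrt (\<sigma> / (2 * pi)) * exp (- (x\<^sup>2 / \<sigma>))
     + sqrt (2 * \<sigma> / (3 * pi)) * (4 * x\<^sup>2 / (9 * \<sigma>) - 2 / 3)
         * exp (- (x\<^sup>2 / (3 * \<sigma>))) * phi_fun \<sigma> x"

definition h_fun :: "real \<Rightarrow> real \<Rightarrow> real" where
  "h_fun \<sigma> x = 1 / 2 - 1 / 2 * I_fun \<sigma> x + sqrt (pi / (2 * \<sigma>)) * J_fun \<sigma> x"

definition first_addend_density :: "real \<Rightarrow> real \<Rightarrow> real" where
  "first_addend_density \<sigma> x =
     (if 0 \<le> x then 4 * x / \<sigma> * exp (- (x\<^sup>2 / \<sigma>)) * h_fun \<sigma> x else 0)"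

end

(*
  Conditioning on the first addend x of the winning pair, symmetry between the two pairs shows that
  its density is 2 f(x) P(x + Y > S), where Y is Rayleigh and S is an independent sum of two Rayleigh
  variables; so h(x) must be identified with the integral of f(y) G(x + y), G the distribution
  function of S. After scaling to sigma = 1,
    G(z) = 1 - exp(-z^2) - z exp(-z^2/2) (sqrt(2 pi)/2 - q(z)),  q(z) = sqrt(2 pi) Q(z).
  Integration by parts reduces the integral of f(y) G(x + y) to elementary terms and the integral
  over y >= 0 of exp(-y^2 - (x+y)^2/2) (sqrt(2 pi)/2 - q(x+y)). The part of the latter with q is the
  Gaussian mass of a planar wedge with an angle of 60 degrees; it and the angular integral in phi
  are both constant multiples of the integral over t >= x of exp(-t^2/6) q(t).
*)
theory Submission
  imports Defs "HOL-Real_Asymp.Real_Asymp"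
begin

section \<open>The Gaussian tail integral\<close>

text \<open>The constants of \<open>phi_fun\<close> come from the position of the wedge. Let s
  unfold the tail q(x + y), and put u = sqrt 3 * (y + x/3), v = x + y + s. The quadrant y, s >= 0
  becomes a wedge between the directions 30 and 90 degrees; its apex lies in direction 60 degrees,
  at distance 2x / sqrt 3, so its bisector passes through the origin. Each half is met by the rays
  from the origin at angles 0 to pi/6 to an edge line at distance x / sqrt 3, and radial integration
  leaves exp(-x^2 / (6 sin^2 theta)). Polar coordinates are avoided: the wedge mass and the angular
  integral are each written as an integral over t >= x of minus the derivative in the parameter, and
  Tonelli exchanges the order. Signs enter only with the difference sqrt(2 pi)/2 - q, where the
  argument passes to Bochner integrals. That h is nonnegative is not read off its formula; it
  follows from h being the integral of a nonnegative function.\<close>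

definition gauss_tail :: "real \<Rightarrow> real" where
  "gauss_tail x = (LBINT u:{x..}. exp (- (u\<^sup>2 / 2)))"

lemma gauss_Q_eq_tail: "gauss_Q x = gauss_tail x / sqrt (2 * pi)"
  by (simp add: gauss_Q_def gauss_tail_def)

lemma has_bochner_integral_gauss_kernel:
  "has_bochner_integral lborel (\<lambda>u. exp (- (u\<^sup>2 / 2))) (sqrt (2 * pi))"
proof -
  have "has_bochner_integral lborel (\<lambda>u. sqrt (2 * pi) * std_normal_density u) (sqrt (2 * pi) * 1)"
    by (intro has_bochner_integral_mult_right)
       (simp add: has_bochner_integral_iff prob_space_normal_density)
  moreover have "(\<lambda>u. sqrt (2 * pi) * std_normal_density u) = (\<lambda>u. exp (- (u\<^sup>2 / 2)))"
    by (auto simp: std_normal_density_def fun_eq_iff)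
  ultimately show ?thesis by simp
qed

lemma set_integrable_gauss_kernel:
  assumes "A \<in> sets borel"
  shows "set_integrable lborel A (\<lambda>u::real. exp (- (u\<^sup>2 / 2)))"
  unfolding set_integrable_def using assms has_bochner_integral_gauss_kernel
  by (intro integrable_mult_indicator) (auto simp: has_bochner_integral_iff)

lemma gauss_tail_nonneg: "0 \<le> gauss_tail x"
  unfolding gauss_tail_def set_lebesgue_integral_def
  by (intro Bochner_Integration.integral_nonneg) auto

lemma nn_integral_gauss_tail:
  "(\<integral>\<^sup>+u. ennreal (exp (- (u\<^sup>2 / 2))) * indicator {x..} u \<partial>lborel) = ennreal (gauss_tail x)"
proof -
  have "ennreal (gauss_tail x) = (\<integral>\<^sup>+u. ennreal (indicator {x..} u * exp (- (u\<^sup>2 / 2))) \<partial>lborel)"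
    unfolding gauss_tail_def set_lebesgue_integral_def
    using set_integrable_gauss_kernel[of "{x..}"]
    by (subst nn_integral_eq_integral) (auto simp: set_integrable_def)
  then show ?thesis
    by (simp add: ennreal_mult ennreal_indicator mult.commute)
qed

text \<open>Every Gaussian integral over a half-line met below takes this shape once the square is
  completed; the slope \<open>c\<close> supplies the factors 1/2 and 1 / sqrt 3.\<close>

lemma nn_integral_gauss_affine:
  assumes "0 < c"
  shows "(\<integral>\<^sup>+y. ennreal (exp (- ((d + c * y)\<^sup>2 / 2))) * indicator {0..} y \<partial>lborel)
    = ennreal (gauss_tail d / c)"
proof -
  let ?I = "\<integral>\<^sup>+y. ennreal (exp (- ((d + c * y)\<^sup>2 / 2))) * indicator {0..} y \<partial>lborel"
  have "indicator {d..} (d + c * y) = (indicator {0..} y :: ennreal)" for y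
    using assms by (auto simp: indicator_def zero_le_mult_iff)
  then have *: "ennreal (gauss_tail d) = ennreal c * ?I"
    unfolding nn_integral_gauss_tail[symmetric]
    using assms by (subst nn_integral_real_affine[where t=d and c=c]) auto
  have "ennreal (gauss_tail d / c) = ennreal (1 / c) * ennreal (gauss_tail d)"
    using assms by (subst ennreal_mult[symmetric]) (auto simp: gauss_tail_nonneg)
  also have "\<dots> = (ennreal (1 / c) * ennreal c) * ?I"
    unfolding * by (rule mult.assoc[symmetric])
  also have "ennreal (1 / c) * ennreal c = 1"
    using assms by (subst ennreal_mult[symmetric]) auto
  finally show ?thesis by simp
qed

text \<open>Turns the tail, up to a constant, into an integral over a compact interval, to which the
  fundamental theorem applies.\<close>

lemma gauss_tail_diff:
  assumes "a \<le> x"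
  shows "gauss_tail x = gauss_tail a - integral {a..x} (\<lambda>u. exp (- (u\<^sup>2 / 2)))"
proof -
  let ?g = "\<lambda>u::real. exp (- (u\<^sup>2 / 2))"
  have "gauss_tail a = (LBINT u:{a..<x}. ?g u) + (LBINT u:{x..}. ?g u)"
    unfolding gauss_tail_def using assms
    by (subst set_integral_Un[symmetric])
       (auto intro: set_integrable_gauss_kernel simp: ivl_disj_un)
  also have "(LBINT u:{a..<x}. ?g u) = (LBINT u:{a..x}. ?g u)"
    by (intro set_integral_discrete_difference[where X="{x}"]) auto
  also have "\<dots> = integral {a..x} ?g"
    by (intro set_borel_integral_eq_integral set_integrable_gauss_kernel) auto
  finally show ?thesis by (simp add: gauss_tail_def)
qed

text \<open>Near x the tail is a constant minus an integral from x - 1; this base point keeps x in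
  the interior of the interval.\<close>

lemma DERIV_gauss_tail: "DERIV gauss_tail x :> - exp (- (x\<^sup>2 / 2))"
proof -
  let ?g = "\<lambda>u::real. exp (- (u\<^sup>2 / 2))"
  have "((\<lambda>y. integral {x - 1..y} ?g) has_real_derivative ?g x) (at x within {x - 1..x + 1})"
    by (intro integral_has_real_derivative continuous_intros) auto
  then have "((\<lambda>y. integral {x - 1..y} ?g) has_real_derivative ?g x) (at x)"
    by (subst (asm) at_within_interior) (auto simp: interior_atLeastAtMost_real)
  then have "((\<lambda>y. gauss_tail (x - 1) - integral {x - 1..y} ?g) has_real_derivative 0 - ?g x) (at x)"
    by (intro DERIV_diff) auto
  then have "(gauss_tail has_real_derivative 0 - ?g x) (at x)"
    by (rule has_field_derivative_transform_within_open[where S="{x - 1<..}"])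
       (auto simp: gauss_tail_diff[of "x - 1", symmetric])
  then show ?thesis by simp
qed

lemma DERIV_gauss_tail_chain [derivative_intros]:
  "(f has_field_derivative f') (at x within A) \<Longrightarrow>
    ((\<lambda>x. gauss_tail (f x)) has_field_derivative - exp (- ((f x)\<^sup>2 / 2)) * f') (at x within A)"
  by (rule DERIV_chain2[OF DERIV_gauss_tail])

lemma isCont_gauss_tail: "isCont gauss_tail x"
  using DERIV_gauss_tail by (rule DERIV_isCont)

lemma continuous_on_gauss_tail: "continuous_on A gauss_tail"
  by (simp add: continuous_at_imp_continuous_on isCont_gauss_tail)

lemma gauss_tail_measurable [measurable]: "gauss_tail \<in> borel_measurable borel"
  by (intro borel_measurable_continuous_onI continuous_on_gauss_tail)

text \<open>Reflection u -> -u together with the total mass sqrt(2 pi). At x = 0 it shows that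
  sqrt(2 pi)/2 is the half mass, the constant that recurs below.\<close>

lemma gauss_tail_uminus: "gauss_tail (- x) = sqrt (2 * pi) - gauss_tail x"
proof -
  let ?g = "\<lambda>u::real. exp (- (u\<^sup>2 / 2))"
  have "{..<x} \<union> {x..} = UNIV" by auto
  have "gauss_tail (- x) = (LBINT u:{..x}. ?g u)"
    unfolding gauss_tail_def by (subst set_integral_reflect) (simp add: atMost_def)
  moreover have "(LBINT u:{..x}. ?g u) = (LBINT u:{..<x}. ?g u)"
    by (intro set_integral_discrete_difference[where X="{x}"]) auto
  moreover have "(LBINT u:{..<x}. ?g u) + gauss_tail x = (LBINT u:UNIV. ?g u)"
    unfolding gauss_tail_def
    by (subst set_integral_Un[symmetric])
       (auto intro: set_integrable_gauss_kernel simp: \<open>{..<x} \<union> {x..} = UNIV\<close>)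
  moreover have "(LBINT u:UNIV. ?g u) = sqrt (2 * pi)"
    using has_bochner_integral_gauss_kernel
    by (simp add: set_lebesgue_integral_def has_bochner_integral_iff)
  ultimately show ?thesis by simp
qed

lemma gauss_tail_antimono: "a \<le> b \<Longrightarrow> gauss_tail b \<le> gauss_tail a"
  by (subst gauss_tail_diff[of a b]) (auto intro!: integral_nonneg integrable_continuous_interval continuous_intros)

lemma gauss_tail_le: "gauss_tail x \<le> sqrt (2 * pi)"
  using gauss_tail_uminus[of x] gauss_tail_nonneg[of "-x"] by simp

lemma gauss_tail_le_half: "0 \<le> x \<Longrightarrow> gauss_tail x \<le> sqrt (2 * pi) / 2"
  using gauss_tail_uminus[of x] gauss_tail_antimono[of "- x" x] by simp

text \<open>For x, y >= 0 one has (x + y)^2 >= x^2 + y^2, so the shifted kernel factors. The crude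
  constant is enough, as the bound only serves the limit at infinity.\<close>

lemma gauss_tail_le_exp:
  assumes "0 \<le> x"
  shows "gauss_tail x \<le> sqrt (2 * pi) * exp (- (x\<^sup>2 / 2))"
proof -
  have le: "- ((x + y)\<^sup>2 / 2) \<le> - (x\<^sup>2 / 2) + - (y\<^sup>2 / 2)" if "0 \<le> y" for y
    using assms that by (simp add: power2_sum field_simps)
  have "ennreal (gauss_tail x)
      = (\<integral>\<^sup>+y. ennreal (exp (- ((x + y)\<^sup>2 / 2))) * indicator {0..} y \<partial>lborel)"
    using nn_integral_gauss_affine[of 1 x] by simp
  also have "\<dots> \<le> (\<integral>\<^sup>+y. ennreal (exp (- (x\<^sup>2 / 2))) * (ennreal (exp (- (y\<^sup>2 / 2))) * indicator {0..} y) \<partial>lborel)"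
    using assms
    by (intro nn_integral_mono)
       (use le in \<open>auto simp: ennreal_mult[symmetric] mult_exp_exp split: split_indicator
             intro!: ennreal_leI\<close>)
  also have "\<dots> = ennreal (exp (- (x\<^sup>2 / 2)) * gauss_tail 0)"
    by (subst nn_integral_cmult) (auto simp: nn_integral_gauss_tail ennreal_mult gauss_tail_nonneg)
  finally have "gauss_tail x \<le> exp (- (x\<^sup>2 / 2)) * gauss_tail 0"
    by (simp add: gauss_tail_nonneg)
  also have "\<dots> \<le> exp (- (x\<^sup>2 / 2)) * sqrt (2 * pi)"
    by (intro mult_left_mono gauss_tail_le) auto
  finally show ?thesis by (simp add: mult.commute)
qed

lemma exp_neg_quadratic_at_top:
  fixes a b c :: real
  assumes "0 < a"
  shows "((\<lambda>t. exp (- (a * t\<^sup>2 + b * t + c))) \<longlongrightarrow> 0) at_top"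
  using assms by real_asymp

lemma gauss_tail_at_top: "(gauss_tail \<longlongrightarrow> 0) at_top"
proof (rule tendsto_sandwich)
  show "\<forall>\<^sub>F x in at_top. 0 \<le> gauss_tail x" by (simp add: gauss_tail_nonneg)
  show "\<forall>\<^sub>F x in at_top. gauss_tail x \<le> sqrt (2 * pi) * exp (- (x\<^sup>2 / 2))"
    using eventually_ge_at_top[of 0] by eventually_elim (rule gauss_tail_le_exp)
  show "((\<lambda>x::real. sqrt (2 * pi) * exp (- (x\<^sup>2 / 2))) \<longlongrightarrow> 0) at_top"
    by real_asymp
qed simp

section \<open>The wedge integral and \<open>phi_fun\<close>\<close>

text \<open>Needed for the angular integral: its antiderivative involves cot and has only a
  one-sided limit at angle 0, so the fundamental theorem must work on an open interval.\<close>

lemma nn_integral_FTC_einterval: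
  fixes f F :: "real \<Rightarrow> real" and a b :: ereal
  assumes "a < b"
    and "\<And>x. a < ereal x \<Longrightarrow> ereal x < b \<Longrightarrow> DERIV F x :> f x"
    and "\<And>x. a < ereal x \<Longrightarrow> ereal x < b \<Longrightarrow> isCont f x"
    and nonneg: "\<And>x. a < ereal x \<Longrightarrow> ereal x < b \<Longrightarrow> 0 \<le> f x"
    and "((F \<circ> real_of_ereal) \<longlongrightarrow> A) (at_right a)"
    and "((F \<circ> real_of_ereal) \<longlongrightarrow> B) (at_left b)"
  shows "(\<integral>\<^sup>+x. ennreal (f x) * indicator (einterval a b) x \<partial>lborel) = ennreal (B - A)"
proof -
  have int: "set_integrable lborel (einterval a b) f" and eq: "(LBINT x=a..b. f x) = B - A"
    by (rule interval_integral_FTC_nonneg[OF assms(1-3) _ assms(5,6)]; simp add: nonneg)+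
  have "(\<integral>\<^sup>+x. ennreal (f x) * indicator (einterval a b) x \<partial>lborel)
      = (\<integral>\<^sup>+x. ennreal (indicator (einterval a b) x * f x) \<partial>lborel)"
    by (intro nn_integral_cong) (auto split: split_indicator)
  also have "\<dots> = ennreal (LBINT x:einterval a b. f x)"
    using int nonneg unfolding set_lebesgue_integral_def set_integrable_def
    by (subst nn_integral_eq_integral) (auto simp: einterval_iff split: split_indicator)
  also have "(LBINT x:einterval a b. f x) = B - A"
    using eq less_imp_le[OF assms(1)] by (simp add: interval_lebesgue_integral_def)
  finally show ?thesis .
qed

text \<open>Increasing x slides the wedge outward along its bisector, so the mass lost is the flux
  through its two edges. By symmetry the edges contribute equally, 1/3 * exp(-t^2/6) * q(t) each,
  which gives the factor 2/3.\<close>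

lemma nn_integral_gauss_wedge:
  assumes "0 \<le> x"
  shows "(\<integral>\<^sup>+y. (\<integral>\<^sup>+s. ennreal (exp (- (3 / 2 * (y + x / 3)\<^sup>2 + (x + y + s)\<^sup>2 / 2)))
        * indicator {0..} s \<partial>lborel) * indicator {0..} y \<partial>lborel)
    = (\<integral>\<^sup>+t. ennreal (2 / 3 * exp (- (t\<^sup>2 / 6)) * gauss_tail t) * indicator {x..} t \<partial>lborel)"
    (is "?L = ?R")
proof -
  define A where "A y s t = 3 / 2 * (y + t / 3)\<^sup>2 + (t + y + s)\<^sup>2 / 2" for y s t :: real
  have A_meas [measurable]: "(\<lambda>x. A (f x) (g x) (h x)) \<in> borel_measurable M"
    if [measurable]: "f \<in> borel_measurable M" "g \<in> borel_measurable M" "h \<in> borel_measurable M"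
    for f g h and M :: "'c measure"
    unfolding A_def by measurable
  \<comment> \<open>The derivative \<open>(2 * y + s + 4 * t / 3)\<close> of \<open>A\<close> in \<open>t\<close> is \<open>1 / 3\<close> of the one in \<open>y\<close> plus \<open>2 / 3\<close> of
    the one in \<open>s\<close>, so after Tonelli both inner integrals are elementary.\<close>
  define D where "D y s t = ennreal ((2 * y + s + 4 * t / 3) * exp (- A y s t))
      * indicator {x..} t * indicator {0..} s * indicator {0..} y" for y s t
  have D_meas [measurable]: "(\<lambda>x. D (f x) (g x) (h x)) \<in> borel_measurable M"
    if [measurable]: "f \<in> borel_measurable M" "g \<in> borel_measurable M" "h \<in> borel_measurable M"
    for f g h and M :: "'c measure"
    unfolding D_def by measurable
  have t_int: "(\<integral>\<^sup>+t. ennreal ((2 * y + s + 4 * t / 3) * exp (- A y s t)) * indicator {x..} t \<partial>lborel)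
      = ennreal (exp (- A y s x))" if "0 \<le> y" "0 \<le> s" for y s
  proof -
    have "A y s t = 2 / 3 * t\<^sup>2 + (2 * y + s) * t + (3 / 2 * y\<^sup>2 + (y + s)\<^sup>2 / 2)" for t
      by (simp add: A_def power2_eq_square field_simps)
    then have "((\<lambda>t. - exp (- A y s t)) \<longlongrightarrow> - 0) at_top"
      by (simp only:) (intro tendsto_minus exp_neg_quadratic_at_top; simp)
    then have "(\<integral>\<^sup>+t. ennreal ((2 * y + s + 4 * t / 3) * exp (- A y s t)) * indicator {x..} t \<partial>lborel)
      = ennreal (0 - (- exp (- A y s x)))"
      using that assms
      by (intro nn_integral_FTC_atLeast)
         (auto simp: A_def power2_eq_square field_simps intro!: derivative_eq_intros)
    then show ?thesis by simp
  qed
  have s_int: "(\<integral>\<^sup>+s. ennreal ((t + y + s) * exp (- A y s t)) * indicator {0..} s \<partial>lborel)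
      = ennreal (exp (- A y 0 t))" if "0 \<le> y" "0 \<le> t" for y t
  proof -
    have "A y s t = 1 / 2 * s\<^sup>2 + (t + y) * s + (3 / 2 * (y + t / 3)\<^sup>2 + (t + y)\<^sup>2 / 2)" for s
      by (simp add: A_def power2_eq_square field_simps)
    then have "((\<lambda>s. - exp (- A y s t)) \<longlongrightarrow> - 0) at_top"
      by (simp only:) (intro tendsto_minus exp_neg_quadratic_at_top; simp)
    then have "(\<integral>\<^sup>+s. ennreal ((t + y + s) * exp (- A y s t)) * indicator {0..} s \<partial>lborel)
      = ennreal (0 - (- exp (- A y 0 t)))"
      using that assms
      by (intro nn_integral_FTC_atLeast)
         (auto simp: A_def power2_eq_square field_simps intro!: derivative_eq_intros)
    then show ?thesis by simp
  qed
  have y_int: "(\<integral>\<^sup>+y. ennreal ((4 * y + s + 2 * t) * exp (- A y s t)) * indicator {0..} y \<partial>lborel)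
      = ennreal (exp (- A 0 s t))" if "0 \<le> s" "0 \<le> t" for s t
  proof -
    have "A y s t = 2 * y\<^sup>2 + (2 * t + s) * y + (t\<^sup>2 / 6 + (t + s)\<^sup>2 / 2)" for y
      by (simp add: A_def power2_eq_square field_simps)
    then have "((\<lambda>y. - exp (- A y s t)) \<longlongrightarrow> - 0) at_top"
      by (simp only:) (intro tendsto_minus exp_neg_quadratic_at_top; simp)
    then have "(\<integral>\<^sup>+y. ennreal ((4 * y + s + 2 * t) * exp (- A y s t)) * indicator {0..} y \<partial>lborel)
      = ennreal (0 - (- exp (- A 0 s t)))"
      using that assms
      by (intro nn_integral_FTC_atLeast)
         (auto simp: A_def power2_eq_square field_simps intro!: derivative_eq_intros)
    then show ?thesis by simp
  qed
  have edge_y: "(\<integral>\<^sup>+y. ennreal (exp (- A y 0 t)) * indicator {0..} y \<partial>lborel)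
      = ennreal (exp (- (t\<^sup>2 / 6)) * (gauss_tail t / 2))" for t
  proof -
    \<comment> \<open>The edge s = 0 lies on a line at distance t / sqrt 3 from the origin, whence
      exp(-t^2/6). Arc length along it, measured from the foot of the perpendicular, is t + 2 *
      y.\<close>
    have "exp (- A y 0 t) = exp (- (t\<^sup>2 / 6)) * exp (- ((t + 2 * y)\<^sup>2 / 2))" for y
      unfolding mult_exp_exp A_def by (simp add: power2_eq_square field_simps)
    then show ?thesis
      using nn_integral_gauss_affine[of 2 t]
      by (simp add: ennreal_mult nn_integral_cmult mult.assoc gauss_tail_nonneg
          del: times_divide_eq_right)
  qed
  have edge_s: "(\<integral>\<^sup>+s. ennreal (exp (- A 0 s t)) * indicator {0..} s \<partial>lborel)
      = ennreal (exp (- (t\<^sup>2 / 6)) * gauss_tail t)" for t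
  proof -
    have "exp (- A 0 s t) = exp (- (t\<^sup>2 / 6)) * exp (- ((t + 1 * s)\<^sup>2 / 2))" for s
      unfolding mult_exp_exp A_def by (simp add: power2_eq_square field_simps)
    then show ?thesis
      using nn_integral_gauss_affine[of 1 t]
      by (simp add: ennreal_mult nn_integral_cmult mult.assoc gauss_tail_nonneg)
  qed
  have "?L = (\<integral>\<^sup>+y. \<integral>\<^sup>+s. \<integral>\<^sup>+t. D y s t \<partial>lborel \<partial>lborel \<partial>lborel)"
  proof (intro nn_integral_cong)
    fix y :: real
    have "(\<integral>\<^sup>+s. ennreal (exp (- A y s x)) * indicator {0..} s \<partial>lborel)
        = (\<integral>\<^sup>+s. \<integral>\<^sup>+t. D y s t \<partial>lborel \<partial>lborel)" if "0 \<le> y"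
      using that t_int[of y]
      by (intro nn_integral_cong) (auto simp: D_def split: split_indicator)
    then show "(\<integral>\<^sup>+s. ennreal (exp (- (3 / 2 * (y + x / 3)\<^sup>2 + (x + y + s)\<^sup>2 / 2)))
        * indicator {0..} s \<partial>lborel) * indicator {0..} y = (\<integral>\<^sup>+s. \<integral>\<^sup>+t. D y s t \<partial>lborel \<partial>lborel)"
      by (cases "0 \<le> y") (auto simp: A_def D_def)
  qed
  also have "\<dots> = (\<integral>\<^sup>+y. \<integral>\<^sup>+t. \<integral>\<^sup>+s. D y s t \<partial>lborel \<partial>lborel \<partial>lborel)"
    by (intro nn_integral_cong lborel_pair.Fubini') measurable
  also have "\<dots> = (\<integral>\<^sup>+t. \<integral>\<^sup>+y. \<integral>\<^sup>+s. D y s t \<partial>lborel \<partial>lborel \<partial>lborel)"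
    by (intro lborel_pair.Fubini') measurable
  also have "\<dots> = ?R"
  proof (intro nn_integral_cong)
    fix t :: real
    show "(\<integral>\<^sup>+y. \<integral>\<^sup>+s. D y s t \<partial>lborel \<partial>lborel)
      = ennreal (2 / 3 * exp (- (t\<^sup>2 / 6)) * gauss_tail t) * indicator {x..} t"
    proof (cases "x \<le> t")
      case True
      with assms have t: "0 \<le> t" by simp
      have split: "D y s t = ennreal (1 / 3) * (ennreal ((4 * y + s + 2 * t) * exp (- A y s t)) * indicator {0..} y) * indicator {0..} s
          + ennreal (2 / 3) * (ennreal ((t + y + s) * exp (- A y s t)) * indicator {0..} s) * indicator {0..} y" for y s
        using True t
        by (auto simp: D_def ennreal_mult[symmetric] ennreal_plus[symmetric] algebra_simps add_divide_distrib
              simp del: ennreal_plus split: split_indicator)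
      have "(\<integral>\<^sup>+y. \<integral>\<^sup>+s. D y s t \<partial>lborel \<partial>lborel) =
        (\<integral>\<^sup>+y. \<integral>\<^sup>+s. ennreal (1 / 3) * (ennreal ((4 * y + s + 2 * t) * exp (- A y s t)) * indicator {0..} y) * indicator {0..} s \<partial>lborel \<partial>lborel)
        + (\<integral>\<^sup>+y. \<integral>\<^sup>+s. ennreal (2 / 3) * (ennreal ((t + y + s) * exp (- A y s t)) * indicator {0..} s) * indicator {0..} y \<partial>lborel \<partial>lborel)"
        unfolding split by (simp add: nn_integral_add)
      also have "(\<integral>\<^sup>+y. \<integral>\<^sup>+s. ennreal (1 / 3) * (ennreal ((4 * y + s + 2 * t) * exp (- A y s t)) * indicator {0..} y) * indicator {0..} s \<partial>lborel \<partial>lborel)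
        = (\<integral>\<^sup>+s. \<integral>\<^sup>+y. ennreal (1 / 3) * (ennreal ((4 * y + s + 2 * t) * exp (- A y s t)) * indicator {0..} y) * indicator {0..} s \<partial>lborel \<partial>lborel)"
        by (intro lborel_pair.Fubini') measurable
      also have "\<dots> = (\<integral>\<^sup>+s. ennreal (1 / 3) * (ennreal (exp (- A 0 s t)) * indicator {0..} s) \<partial>lborel)"
        using t y_int
        by (intro nn_integral_cong)
           (auto simp: nn_integral_cmult nn_integral_multc split: split_indicator)
      also have "\<dots> = ennreal (1 / 3) * ennreal (exp (- (t\<^sup>2 / 6)) * gauss_tail t)"
        by (simp add: nn_integral_cmult edge_s)
      also have "(\<integral>\<^sup>+y. \<integral>\<^sup>+s. ennreal (2 / 3) * (ennreal ((t + y + s) * exp (- A y s t)) * indicator {0..} s) * indicator {0..} y \<partial>lborel \<partial>lborel)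
        = (\<integral>\<^sup>+y. ennreal (2 / 3) * (ennreal (exp (- A y 0 t)) * indicator {0..} y) \<partial>lborel)"
        using t s_int
        by (intro nn_integral_cong)
           (auto simp: nn_integral_cmult nn_integral_multc split: split_indicator)
      also have "\<dots> = ennreal (2 / 3) * ennreal (exp (- (t\<^sup>2 / 6)) * (gauss_tail t / 2))"
        by (simp add: nn_integral_cmult edge_y)
      finally show ?thesis
        using True by (simp add: ennreal_mult[symmetric] ennreal_plus[symmetric] gauss_tail_nonneg
            del: ennreal_plus)
    qed (simp add: D_def)
  qed
  finally show ?thesis .
qed

section \<open>The angular integral\<close>

lemma sin_pos_pi6: "0 < \<theta> \<Longrightarrow> \<theta> < pi / 6 \<Longrightarrow> 0 < sin \<theta>"
  using pi_gt_zero by (intro sin_gt_zero) auto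

text \<open>The integrand is minus the t-derivative of exp(-t^2 / (6 sin^2 theta)). Substituting w =
  t / sqrt 3 * cot theta splits the exponent as t^2/6 + w^2/2, because 1 / sin^2 = 1 + cot^2. The
  angle pi/6 has cotangent sqrt 3 and gives w = t; the angle 0 gives w = infinity, which uses t >
  0.\<close>

lemma nn_integral_angle:
  assumes t: "0 < t"
  shows "(\<integral>\<^sup>+\<theta>. ennreal (t / (3 * (sin \<theta>)\<^sup>2) * exp (- (t\<^sup>2 / (6 * (sin \<theta>)\<^sup>2))))
        * indicator {0<..<pi / 6} \<theta> \<partial>lborel)
    = ennreal (1 / sqrt 3 * exp (- (t\<^sup>2 / 6)) * gauss_tail t)"
proof -
  let ?F = "\<lambda>\<theta>. 1 / sqrt 3 * exp (- (t\<^sup>2 / 6)) * gauss_tail (t / sqrt 3 * (cos \<theta> / sin \<theta>))"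
  let ?f = "\<lambda>\<theta>. t / (3 * (sin \<theta>)\<^sup>2) * exp (- (t\<^sup>2 / (6 * (sin \<theta>)\<^sup>2)))"
  have "(\<integral>\<^sup>+\<theta>. ennreal (?f \<theta>) * indicator (einterval (ereal 0) (ereal (pi / 6))) \<theta> \<partial>lborel)
    = ennreal (?F (pi / 6) - 0)"
  proof (rule nn_integral_FTC_einterval[where F="?F"])
    fix \<theta> assume "ereal 0 < ereal \<theta>" "ereal \<theta> < ereal (pi / 6)"
    then have s: "0 < sin \<theta>" by (intro sin_pos_pi6) auto
    then show "isCont ?f \<theta>" by (intro continuous_intros) auto
    show "0 \<le> ?f \<theta>" using t by simp
    have sc: "(cos \<theta>)\<^sup>2 = 1 - (sin \<theta>)\<^sup>2" by (simp add: cos_squared_eq)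
    have d: "((\<lambda>\<theta>. t / sqrt 3 * (cos \<theta> / sin \<theta>)) has_real_derivative
        t / sqrt 3 * (- 1 / (sin \<theta>)\<^sup>2)) (at \<theta>)"
      using s DERIV_cot[of \<theta>] by (intro DERIV_cmult) (simp add: cot_def[abs_def] inverse_eq_divide)
    have "- (t\<^sup>2 / 6) + - ((t / sqrt 3 * (cos \<theta> / sin \<theta>))\<^sup>2 / 2) = - (t\<^sup>2 / (6 * (sin \<theta>)\<^sup>2))"
      using s by (simp add: power_mult_distrib power_divide sc field_simps)
    then have e: "exp (- (t\<^sup>2 / 6)) * exp (- ((t / sqrt 3 * (cos \<theta> / sin \<theta>))\<^sup>2 / 2))
        = exp (- (t\<^sup>2 / (6 * (sin \<theta>)\<^sup>2)))"
      by (simp only: mult_exp_exp)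
    have "(?F has_real_derivative 1 / sqrt 3 * exp (- (t\<^sup>2 / 6)) *
        (- exp (- ((t / sqrt 3 * (cos \<theta> / sin \<theta>))\<^sup>2 / 2)) * (t / sqrt 3 * (- 1 / (sin \<theta>)\<^sup>2)))) (at \<theta>)"
      by (intro DERIV_cmult DERIV_gauss_tail_chain d)
    moreover have "1 / r * u * (- v * (t / r * (- 1 / q))) = t / (r * r * q) * (u * v)" for r u v q :: real
      by (simp add: field_simps)
    ultimately have "(?F has_real_derivative t / (sqrt 3 * sqrt 3 * (sin \<theta>)\<^sup>2)
        * (exp (- (t\<^sup>2 / 6)) * exp (- ((t / sqrt 3 * (cos \<theta> / sin \<theta>))\<^sup>2 / 2)))) (at \<theta>)"
      by (simp only:)
    then show "(?F has_real_derivative ?f \<theta>) (at \<theta>)"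
      unfolding e by simp
  next
    have "filterlim (\<lambda>\<theta>. t / sqrt 3 * (cos \<theta> / sin \<theta>)) at_top (at_right 0)"
      using t by real_asymp
    then have "((\<lambda>\<theta>. gauss_tail (t / sqrt 3 * (cos \<theta> / sin \<theta>))) \<longlongrightarrow> 0) (at_right 0)"
      by (rule filterlim_compose[OF gauss_tail_at_top])
    then have "(?F \<longlongrightarrow> 1 / sqrt 3 * exp (- (t\<^sup>2 / 6)) * 0) (at_right 0)"
      by (intro tendsto_mult_left)
    then show "((?F \<circ> real_of_ereal) \<longlongrightarrow> 0) (at_right (ereal 0))"
      by (simp only: ereal_tendsto_simps mult_zero_right)
  next
    have "sin (pi / 6) \<noteq> 0" by (simp add: sin_30)
    then have "isCont (\<lambda>\<theta>. t / sqrt 3 * (cos \<theta> / sin \<theta>)) (pi / 6)"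
      by (intro continuous_intros)
    then have "isCont (\<lambda>\<theta>. gauss_tail (t / sqrt 3 * (cos \<theta> / sin \<theta>))) (pi / 6)"
      by (rule isCont_o2) (rule isCont_gauss_tail)
    then have "isCont ?F (pi / 6)"
      by (rule continuous_mult_left)
    then have "(?F \<longlongrightarrow> ?F (pi / 6)) (at_left (pi / 6))"
      unfolding isCont_def by (rule filterlim_mono[OF _ order_refl at_le]) simp
    then show "((?F \<circ> real_of_ereal) \<longlongrightarrow> ?F (pi / 6)) (at_left (ereal (pi / 6)))"
      by (simp only: ereal_tendsto_simps)
  qed auto
  then show ?thesis by (simp add: cos_30 sin_30)
qed

text \<open>The exponential at x is recovered by integrating minus its t-derivative over t >= x;
  after Tonelli the angular integral is elementary for each t.\<close>

lemma nn_integral_craig: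
  assumes "0 \<le> x"
  shows "(\<integral>\<^sup>+\<theta>. ennreal (exp (- (x\<^sup>2 / (6 * (sin \<theta>)\<^sup>2)))) * indicator {0<..<pi / 6} \<theta> \<partial>lborel)
    = (\<integral>\<^sup>+t. ennreal (1 / sqrt 3 * exp (- (t\<^sup>2 / 6)) * gauss_tail t) * indicator {x..} t \<partial>lborel)"
    (is "?L = ?R")
proof -
  define D where "D \<theta> t = ennreal (t / (3 * (sin \<theta>)\<^sup>2) * exp (- (t\<^sup>2 / (6 * (sin \<theta>)\<^sup>2))))
    * indicator {x..} t * indicator {0<..<pi / 6} \<theta>" for \<theta> t :: real
  have [measurable]: "(\<lambda>(\<theta>, t). D \<theta> t) \<in> borel_measurable (lborel \<Otimes>\<^sub>M lborel)"
    unfolding D_def by measurable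
  have "?L = (\<integral>\<^sup>+\<theta>. \<integral>\<^sup>+t. D \<theta> t \<partial>lborel \<partial>lborel)"
  proof (intro nn_integral_cong)
    fix \<theta> :: real
    show "ennreal (exp (- (x\<^sup>2 / (6 * (sin \<theta>)\<^sup>2)))) * indicator {0<..<pi / 6} \<theta> = (\<integral>\<^sup>+t. D \<theta> t \<partial>lborel)"
    proof (cases "\<theta> \<in> {0<..<pi / 6}")
      case True
      then have s: "0 < sin \<theta>" by (intro sin_pos_pi6) auto
      define c where "c = 1 / (6 * (sin \<theta>)\<^sup>2)"
      have c: "0 < c" using s by (simp add: c_def)
      have "((\<lambda>t. - exp (- (c * t\<^sup>2 + 0 * t + 0))) \<longlongrightarrow> - 0) at_top"
        using c by (intro tendsto_minus exp_neg_quadratic_at_top)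
      then have "(\<integral>\<^sup>+t. ennreal (2 * c * t * exp (- (c * t\<^sup>2))) * indicator {x..} t \<partial>lborel)
          = ennreal (0 - (- exp (- (c * x\<^sup>2))))"
        using assms c
        by (intro nn_integral_FTC_atLeast) (auto intro!: derivative_eq_intros)
      then show ?thesis using True by (simp add: D_def c_def)
    qed (simp add: D_def)
  qed
  also have "\<dots> = (\<integral>\<^sup>+t. \<integral>\<^sup>+\<theta>. D \<theta> t \<partial>lborel \<partial>lborel)"
    by (intro lborel_pair.Fubini') measurable
  also have "\<dots> = ?R"
  proof (rule nn_integral_cong_AE)
    \<comment> \<open>For x = 0 the range contains t = 0, where the two integrands really differ:
      the left one is 0, the right one is not.\<close>
    have "AE t in lborel. t \<noteq> (0::real)" by (rule AE_lborel_singleton)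
    then show "AE t in lborel. (\<integral>\<^sup>+\<theta>. D \<theta> t \<partial>lborel)
        = ennreal (1 / sqrt 3 * exp (- (t\<^sup>2 / 6)) * gauss_tail t) * indicator {x..} t"
    proof eventually_elim
      case (elim t)
      show ?case
      proof (cases "x \<le> t")
        case True
        then have "0 < t" using elim assms by simp
        then show ?thesis using True nn_integral_angle[of t] by (simp add: D_def)
      qed (simp add: D_def)
    qed
  qed
  finally show ?thesis .
qed

text \<open>The angular integral of \<open>phi_fun\<close> at \<sigma> = 1, named after Craig's
  polar representation of Q.\<close>

definition craig :: "real \<Rightarrow> real" where
  "craig x = (LBINT \<theta>:{0..pi / 6}. exp (- (x\<^sup>2 / (6 * (sin \<theta>)\<^sup>2))))"

lemma craig_nonneg: "0 \<le> craig x"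
  unfolding craig_def set_lebesgue_integral_def
  by (intro Bochner_Integration.integral_nonneg) auto

lemma nn_integral_craig_eq:
  "(\<integral>\<^sup>+\<theta>. ennreal (exp (- (x\<^sup>2 / (6 * (sin \<theta>)\<^sup>2)))) * indicator {0<..<pi / 6} \<theta> \<partial>lborel)
    = ennreal (craig x)"
proof -
  let ?f = "\<lambda>\<theta>::real. exp (- (x\<^sup>2 / (6 * (sin \<theta>)\<^sup>2)))"
  have "integrable lborel (\<lambda>\<theta>. indicator {0<..<pi / 6} \<theta> *\<^sub>R ?f \<theta>)"
    by (intro integrableI_bounded_set_indicator[where B=1]) auto
  then have "(\<integral>\<^sup>+\<theta>. ennreal (indicator {0<..<pi / 6} \<theta> *\<^sub>R ?f \<theta>) \<partial>lborel)
      = ennreal (LBINT \<theta>:{0<..<pi / 6}. ?f \<theta>)"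
    unfolding set_lebesgue_integral_def by (intro nn_integral_eq_integral) auto
  also have "(LBINT \<theta>:{0<..<pi / 6}. ?f \<theta>) = craig x"
    unfolding craig_def by (intro set_integral_discrete_difference[where X="{0, pi / 6}"]) auto
  finally show ?thesis
    by (simp add: ennreal_mult ennreal_indicator mult.commute)
qed

text \<open>The constant sqrt(2 pi)/2 contributes the Q term of \<open>phi_fun\<close>, the tail
  contributes its angular integral. Completing the square in y extracts the common factor
  exp(-x^2/3).\<close>

lemma has_bochner_integral_gauss_product:
  assumes "0 \<le> x"
  shows "has_bochner_integral lborel
    (\<lambda>y. indicator {0..} y * (exp (- y\<^sup>2 - (x + y)\<^sup>2 / 2) * (sqrt (2 * pi) / 2 - gauss_tail (x + y))))
    (exp (- (x\<^sup>2 / 3)) / sqrt 3 * phi_fun 1 x)"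
proof -
  let ?e = "\<lambda>y. exp (- y\<^sup>2 - (x + y)\<^sup>2 / 2)"
  let ?c = "exp (- (x\<^sup>2 / 3))"
  \<comment> \<open>The same completed square in two shapes: \<open>e1\<close> fits the affine
    substitution, \<open>e2\<close> the exponent of the wedge.\<close>
  have e1: "?e y = ?c * exp (- ((x / sqrt 3 + sqrt 3 * y)\<^sup>2 / 2))" for y
    unfolding mult_exp_exp by (simp add: power2_sum power_mult_distrib power_divide field_simps)
  have e2: "?e y = ?c * exp (- (3 / 2 * (y + x / 3)\<^sup>2))" for y
    unfolding mult_exp_exp by (simp add: power2_sum power_divide field_simps)
  have "(\<integral>\<^sup>+y. ennreal (?e y) * indicator {0..} y \<partial>lborel)
      = ennreal (?c * (gauss_tail (x / sqrt 3) / sqrt 3))"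
    unfolding e1 using nn_integral_gauss_affine[of "sqrt 3" "x / sqrt 3"]
    by (simp add: ennreal_mult nn_integral_cmult mult.assoc gauss_tail_nonneg
          del: times_divide_eq_right)
  then have i1: "has_bochner_integral lborel (\<lambda>y. indicator {0..} y * ?e y)
      (?c * (gauss_tail (x / sqrt 3) / sqrt 3))"
    by (intro has_bochner_integral_nn_integral)
       (auto simp: gauss_tail_nonneg ennreal_mult ennreal_indicator mult.commute)
  have w: "(\<integral>\<^sup>+t. ennreal (2 / 3 * exp (- (t\<^sup>2 / 6)) * gauss_tail t) * indicator {x..} t \<partial>lborel)
      = ennreal (2 / sqrt 3 * craig x)"
  proof -
    have "ennreal (2 / 3 * exp (- (t\<^sup>2 / 6)) * gauss_tail t)
        = ennreal (2 / sqrt 3) * ennreal (1 / sqrt 3 * exp (- (t\<^sup>2 / 6)) * gauss_tail t)" for t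
      by (subst ennreal_mult[symmetric]) (auto simp: gauss_tail_nonneg)
    then show ?thesis
      using nn_integral_craig[OF assms] craig_nonneg[of x]
      by (simp add: nn_integral_cmult mult.assoc nn_integral_craig_eq ennreal_mult
          del: times_divide_eq_right times_divide_eq_left)
  qed
  have inner: "(\<integral>\<^sup>+s. ennreal (exp (- (3 / 2 * (y + x / 3)\<^sup>2 + (x + y + s)\<^sup>2 / 2))) * indicator {0..} s \<partial>lborel)
      = ennreal (exp (- (3 / 2 * (y + x / 3)\<^sup>2)) * gauss_tail (x + y))" for y
  proof -
    have "exp (- (3 / 2 * (y + x / 3)\<^sup>2 + (x + y + s)\<^sup>2 / 2))
        = exp (- (3 / 2 * (y + x / 3)\<^sup>2)) * exp (- ((x + y + 1 * s)\<^sup>2 / 2))" for s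
      unfolding mult_exp_exp by simp
    then show ?thesis using nn_integral_gauss_affine[of 1 "x + y"]
      by (simp add: ennreal_mult nn_integral_cmult mult.assoc gauss_tail_nonneg)
  qed
  have "(\<integral>\<^sup>+y. ennreal (?e y * gauss_tail (x + y)) * indicator {0..} y \<partial>lborel)
      = ennreal (?c * (2 / sqrt 3 * craig x))"
    using nn_integral_gauss_wedge[OF assms] craig_nonneg[of x] unfolding inner w e2
    by (simp add: ennreal_mult nn_integral_cmult mult.assoc gauss_tail_nonneg
          del: times_divide_eq_right times_divide_eq_left)
  then have i2: "has_bochner_integral lborel (\<lambda>y. indicator {0..} y * (?e y * gauss_tail (x + y)))
      (?c * (2 / sqrt 3 * craig x))"
    by (intro has_bochner_integral_nn_integral)
       (auto simp: gauss_tail_nonneg craig_nonneg ennreal_mult ennreal_indicator mult.commute)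
  have phi: "phi_fun 1 x = sqrt (2 * pi) / 2 * gauss_tail (x / sqrt 3) - 2 * craig x"
  proof -
    have "pi * (g / sqrt (2 * pi)) = sqrt (2 * pi) / 2 * g" for g
    proof -
      define c where "c = sqrt (2 * pi)"
      have "0 < c" "pi = c * c / 2" by (auto simp: c_def)
      from this(1) show ?thesis
        unfolding c_def[symmetric] \<open>pi = c * c / 2\<close> by simp
    qed
    then show ?thesis by (simp add: phi_fun_def craig_def gauss_Q_eq_tail)
  qed
  have "has_bochner_integral lborel
    (\<lambda>y. sqrt (2 * pi) / 2 * (indicator {0..} y * ?e y) - indicator {0..} y * (?e y * gauss_tail (x + y)))
    (sqrt (2 * pi) / 2 * (?c * (gauss_tail (x / sqrt 3) / sqrt 3)) - ?c * (2 / sqrt 3 * craig x))"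
    by (intro has_bochner_integral_diff has_bochner_integral_mult_right i1 i2)
  also have "(\<lambda>y. sqrt (2 * pi) / 2 * (indicator {0..} y * ?e y) - indicator {0..} y * (?e y * gauss_tail (x + y)))
    = (\<lambda>y. indicator {0..} y * (?e y * (sqrt (2 * pi) / 2 - gauss_tail (x + y))))"
    by (auto simp: fun_eq_iff algebra_simps)
  also have "sqrt (2 * pi) / 2 * (?c * (gauss_tail (x / sqrt 3) / sqrt 3)) - ?c * (2 / sqrt 3 * craig x)
    = ?c / sqrt 3 * phi_fun 1 x"
    unfolding phi by (simp add: field_simps)
  finally show ?thesis .
qed

section \<open>The standard case \<open>\<sigma> = 1\<close>\<close>

lemma rayleigh_density_nonneg: "0 < \<sigma> \<Longrightarrow> 0 \<le> rayleigh_density \<sigma> x"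
  by (simp add: rayleigh_density_def)

lemma rayleigh_density_measurable [measurable]: "rayleigh_density \<sigma> \<in> borel_measurable borel"
  unfolding rayleigh_density_def by measurable

lemma nn_integral_rayleigh_lessThan:
  "(\<integral>\<^sup>+b. ennreal (rayleigh_density 1 b) * indicator {..<c} b \<partial>lborel)
    = ennreal (if 0 \<le> c then 1 - exp (- c\<^sup>2) else 0)"
proof (cases "0 \<le> c")
  case True
  have "(\<integral>\<^sup>+b. ennreal (rayleigh_density 1 b) * indicator {..<c} b \<partial>lborel)
      = (\<integral>\<^sup>+b. ennreal (2 * b * exp (- b\<^sup>2)) * indicator {0..c} b \<partial>lborel)"
  proof (rule nn_integral_cong_AE)
    have "AE b in lborel. b \<noteq> c" by (rule AE_lborel_singleton)
    then show "AE b in lborel. ennreal (rayleigh_density 1 b) * indicator {..<c} b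
        = ennreal (2 * b * exp (- b\<^sup>2)) * indicator {0..c} b"
      by eventually_elim (auto simp: rayleigh_density_def split: split_indicator)
  qed
  also have "\<dots> = ennreal (- exp (- c\<^sup>2) - - exp (- 0\<^sup>2))"
    using True by (intro nn_integral_FTC_Icc) (auto intro!: derivative_eq_intros)
  finally show ?thesis using True by simp
next
  case False
  then have "(\<integral>\<^sup>+b. ennreal (rayleigh_density 1 b) * indicator {..<c} b \<partial>lborel)
      = (\<integral>\<^sup>+b. 0 \<partial>(lborel :: real measure))"
    by (intro nn_integral_cong) (auto simp: rayleigh_density_def split: split_indicator)
  then show ?thesis using False by simp
qed

text \<open>The \<open>G\<close> of the overview. The closed formula is even in z, so it is a
  distribution function only on z >= 0, where alone it is used.\<close>

definition rayleigh_sum_cdf :: "real \<Rightarrow> real" where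
  "rayleigh_sum_cdf z = 1 - exp (- z\<^sup>2) - z * exp (- (z\<^sup>2 / 2)) * (sqrt (2 * pi) / 2 - gauss_tail z)"

lemma rayleigh_sum_cdf_le_1: "0 \<le> z \<Longrightarrow> rayleigh_sum_cdf z \<le> 1"
proof -
  assume z: "0 \<le> z"
  then have "0 \<le> sqrt (2 * pi) / 2 - gauss_tail z"
    using gauss_tail_le_half[of z] by simp
  with z have "0 \<le> z * exp (- (z\<^sup>2 / 2)) * (sqrt (2 * pi) / 2 - gauss_tail z)"
    by (intro mult_nonneg_nonneg) auto
  moreover have "0 \<le> exp (- z\<^sup>2)" by simp
  ultimately show ?thesis unfolding rayleigh_sum_cdf_def by linarith
qed

lemma
  assumes z: "0 \<le> z"
  shows nn_integral_rayleigh_sum: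
      "(\<integral>\<^sup>+a. ennreal (rayleigh_density 1 a)
          * (\<integral>\<^sup>+b. ennreal (rayleigh_density 1 b) * indicator {..<z - a} b \<partial>lborel) \<partial>lborel)
        = ennreal (rayleigh_sum_cdf z)" (is ?A)
    and rayleigh_sum_cdf_nonneg: "0 \<le> rayleigh_sum_cdf z" (is ?B)
proof -
  let ?f = "\<lambda>a. 2 * a * exp (- a\<^sup>2) * (1 - exp (- (z - a)\<^sup>2))"
  \<comment> \<open>With E = exp(-a^2 - (z - a)^2), write -2 * a * E = (z - 2 * a) * E - z * E. The
    first part is the derivative of E/2; the second is a Gaussian in 2 * a - z and integrates to the
    tail.\<close>
  let ?F = "\<lambda>a. - exp (- a\<^sup>2) + 1 / 2 * exp (- a\<^sup>2 - (z - a)\<^sup>2)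
    + z / 2 * exp (- (z\<^sup>2 / 2)) * gauss_tail (2 * a - z)"
  have D: "(?F has_real_derivative ?f a) (at a)" for a
  proof -
    have e: "exp (- a\<^sup>2 - (z - a)\<^sup>2) = exp (- (z\<^sup>2 / 2)) * exp (- ((2 * a - z)\<^sup>2 / 2))"
      unfolding mult_exp_exp by (simp add: power2_eq_square field_simps)
    have "(?F has_real_derivative 2 * a * exp (- a\<^sup>2)
        + 1 / 2 * (exp (- a\<^sup>2 - (z - a)\<^sup>2) * (- 2 * a + 2 * (z - a)))
        + z / 2 * exp (- (z\<^sup>2 / 2)) * (- exp (- ((2 * a - z)\<^sup>2 / 2)) * 2)) (at a)"
      by (auto intro!: derivative_eq_intros)
    also have "2 * a * exp (- a\<^sup>2)
        + 1 / 2 * (exp (- a\<^sup>2 - (z - a)\<^sup>2) * (- 2 * a + 2 * (z - a)))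
        + z / 2 * exp (- (z\<^sup>2 / 2)) * (- exp (- ((2 * a - z)\<^sup>2 / 2)) * 2)
        = 2 * a * exp (- a\<^sup>2) - 2 * a * exp (- a\<^sup>2 - (z - a)\<^sup>2)"
      unfolding e by (simp add: algebra_simps)
    also have "\<dots> = ?f a"
      by (simp add: algebra_simps mult_exp_exp)
    finally show ?thesis .
  qed
  have f: "0 \<le> ?f a" if "0 \<le> a" for a
    using that by simp
  have v: "?F z - ?F 0 = rayleigh_sum_cdf z"
    by (simp add: rayleigh_sum_cdf_def gauss_tail_uminus field_simps)
  have "(\<integral>\<^sup>+a. ennreal (rayleigh_density 1 a)
          * (\<integral>\<^sup>+b. ennreal (rayleigh_density 1 b) * indicator {..<z - a} b \<partial>lborel) \<partial>lborel)
      = (\<integral>\<^sup>+a. ennreal (?f a) * indicator {0..z} a \<partial>lborel)"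
    unfolding nn_integral_rayleigh_lessThan
    by (intro nn_integral_cong)
       (auto simp: rayleigh_density_def ennreal_mult split: split_indicator)
  also have "\<dots> = ennreal (?F z - ?F 0)"
    using z f D by (intro nn_integral_FTC_Icc) auto
  finally show ?A unfolding v .
  \<comment> \<open>The sign cannot be read off \<open>?A\<close>, since \<open>ennreal\<close> maps
    negative reals to 0; it follows from the monotonicity of the antiderivative.\<close>
  have "?F 0 \<le> ?F z"
    using z D f by (intro DERIV_nonneg_imp_nondecreasing[of 0 z ?F]) blast+
  then show ?B using v by simp
qed

lemma has_bochner_integral_rayleigh_weighted_cdf:
  assumes x: "0 \<le> x"
  shows "has_bochner_integral lborel (\<lambda>y. indicator {0..} y * (2 * y * exp (- y\<^sup>2) * rayleigh_sum_cdf (x + y)))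
     (h_fun 1 x)"
proof -
  define s where "s = sqrt (2 * pi) / 2"
  \<comment> \<open>Chosen so that \<open>?L\<close> has an antiderivative in closed form: 2/3 is
    the slope of the linear factor in \<open>?D\<close>, and 4 * x^2 / 9 is the remainder left by
    dividing 2 * y * (x + y) by 3 * y + x.\<close>
  define c where "c = 2 / 3 - 4 * x\<^sup>2 / 9"
  let ?B = "\<lambda>y. exp (- y\<^sup>2 - (x + y)\<^sup>2 / 2)"
  let ?M = "\<lambda>y. exp (- y\<^sup>2 - (x + y)\<^sup>2)"
  let ?k = "\<lambda>y. ?B y * (s - gauss_tail (x + y))"
  let ?w = "\<lambda>y. 2 * y * exp (- y\<^sup>2) * rayleigh_sum_cdf (x + y)"
  let ?L = "\<lambda>y. ?w y + c * ?k y"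
  \<comment> \<open>\<open>2 * y * (x + y) = (2 / 3 * y + 4 * x / 9) * (3 * y + x) - 4 * x\<^sup>2 / 9\<close>, where \<open>3 * y + x\<close> is the
    derivative of the exponent in \<open>?B\<close>: integration by parts leaves a multiple of \<open>?k\<close>.\<close>
  let ?D = "\<lambda>y. - exp (- y\<^sup>2) + (2 / 3 * y + 4 * x / 9) * ?k y + 2 / 3 * ?M y
    - 4 * x / 9 * exp (- (x\<^sup>2 / 2)) * gauss_tail (2 * y + x)"
  have k: "has_bochner_integral lborel (\<lambda>y. indicator {0..} y * ?k y) (exp (- (x\<^sup>2 / 3)) / sqrt 3 * phi_fun 1 x)"
    unfolding s_def using has_bochner_integral_gauss_product[OF x] .
  have MB: "?M y = ?B y * exp (- ((x + y)\<^sup>2 / 2))" for y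
    unfolding mult_exp_exp by (simp add: field_simps)
  have M2: "exp (- (x\<^sup>2 / 2)) * exp (- ((2 * y + x)\<^sup>2 / 2)) = ?M y" for y
    unfolding mult_exp_exp by (simp add: power2_eq_square field_simps)
  have wexp: "?w y = 2 * y * exp (- y\<^sup>2) - 2 * y * ?M y - 2 * y * (x + y) * ?k y" for y
  proof -
    have "?M y = exp (- y\<^sup>2) * exp (- (x + y)\<^sup>2)" "?B y = exp (- y\<^sup>2) * exp (- ((x + y)\<^sup>2 / 2))"
      unfolding mult_exp_exp by simp_all
    then show ?thesis unfolding rayleigh_sum_cdf_def s_def by (simp add: algebra_simps)
  qed
  have D: "(?D has_real_derivative ?L y) (at y)" for y
  proof -
    have dB: "(?B has_real_derivative - (3 * y + x) * ?B y) (at y)"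
      by (auto intro!: derivative_eq_intros simp: algebra_simps)
    have dM: "(?M has_real_derivative - (4 * y + 2 * x) * ?M y) (at y)"
      by (auto intro!: derivative_eq_intros simp: algebra_simps)
    have dq: "((\<lambda>y. s - gauss_tail (x + y)) has_real_derivative exp (- ((x + y)\<^sup>2 / 2))) (at y)"
      by (auto intro!: derivative_eq_intros)
    have dk: "(?k has_real_derivative - (3 * y + x) * ?k y + ?M y) (at y)"
      by (rule DERIV_cong[OF DERIV_mult[OF dB dq]]) (simp only: MB mult_ac)
    have de: "((\<lambda>y. - exp (- y\<^sup>2)) has_real_derivative 2 * y * exp (- y\<^sup>2)) (at y)"
      by (auto intro!: derivative_eq_intros)
    have dl: "((\<lambda>y. 2 / 3 * y + 4 * x / 9) has_real_derivative 2 / 3) (at y)"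
      by (auto intro!: derivative_eq_intros)
    have dq2: "((\<lambda>y. exp (- (x\<^sup>2 / 2)) * gauss_tail (2 * y + x)) has_real_derivative - 2 * ?M y) (at y)"
      unfolding M2[symmetric] by (auto intro!: derivative_eq_intros)
    \<comment> \<open>Here \<open>e\<close>, \<open>k\<close>, \<open>m\<close> stand for exp(-y^2),
      \<open>?k y\<close>, \<open>?M y\<close>. The derivative of 2/3 * \<open>?M\<close> brings the
      \<open>m\<close> terms to -2 * y * m - 8/9 * x * m, and the tail term of \<open>?D\<close>
      cancels the last one.\<close>
    have poly: "2 * y * e + (2 / 3 * k + (- (3 * y + x) * k + m) * (2 / 3 * y + 4 * x / 9))
        + 2 / 3 * (- (4 * y + 2 * x) * m) - 4 * x / 9 * (- 2 * m)
      = 2 * y * e - 2 * y * m - 2 * y * (x + y) * k + (2 / 3 - 4 * x\<^sup>2 / 9) * k" for e k m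
      by (simp add: field_simps power2_eq_square)
    show ?thesis
      unfolding wexp c_def poly[symmetric] mult.assoc[of "4 * x / 9"]
      by (intro DERIV_diff DERIV_add DERIV_mult DERIV_cmult de dl dk dM dq2)
  qed
  have Dlim: "(?D \<longlongrightarrow> 0) at_top"
  proof -
    have 1: "((\<lambda>y::real. - exp (- y\<^sup>2)) \<longlongrightarrow> 0) at_top" by real_asymp
    have "((\<lambda>y::real. (2 / 3 * y + 4 * x / 9) * exp (- (3 / 2 * y\<^sup>2 + x * y + x\<^sup>2 / 2))) \<longlongrightarrow> 0) at_top"
      by real_asymp
    moreover have "- y\<^sup>2 - (x + y)\<^sup>2 / 2 = - (3 / 2 * y\<^sup>2 + x * y + x\<^sup>2 / 2)" for y
      by (simp add: power2_eq_square field_simps)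
    ultimately have 2: "((\<lambda>y. (2 / 3 * y + 4 * x / 9) * ?B y) \<longlongrightarrow> 0) at_top"
      by (simp only:)
    have 3: "((\<lambda>y. gauss_tail (x + y)) \<longlongrightarrow> 0) at_top" 
      by (rule filterlim_compose[OF gauss_tail_at_top]) real_asymp
    have 4: "((\<lambda>y. gauss_tail (2 * y + x)) \<longlongrightarrow> 0) at_top" 
      by (rule filterlim_compose[OF gauss_tail_at_top]) real_asymp
    have "((\<lambda>y. exp (- (2 * y\<^sup>2 + (2 * x) * y + x\<^sup>2))) \<longlongrightarrow> 0) at_top"
      by (rule exp_neg_quadratic_at_top) simp
    moreover have "- y\<^sup>2 - (x + y)\<^sup>2 = - (2 * y\<^sup>2 + (2 * x) * y + x\<^sup>2)" for y
      by (simp add: power2_eq_square field_simps)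
    ultimately have 5: "(?M \<longlongrightarrow> 0) at_top" by (simp only:)
    have "((\<lambda>y. - exp (- y\<^sup>2) + ((2 / 3 * y + 4 * x / 9) * ?B y) * (s - gauss_tail (x + y)) + 2 / 3 * ?M y
      - 4 * x / 9 * exp (- (x\<^sup>2 / 2)) * gauss_tail (2 * y + x)) \<longlongrightarrow> 0 + 0 * (s - 0) + 2 / 3 * 0 - 4 * x / 9 * exp (- (x\<^sup>2 / 2)) * 0) at_top"
      by (intro tendsto_intros 1 2 3 4 5)
    then show ?thesis by (simp only: mult.assoc) simp
  qed
  have base: "integrable lborel (\<lambda>y::real. indicator {0..} y * (2 * y * exp (- y\<^sup>2)))"
  proof -
    have "integrable lborel (\<lambda>y::real. 2 * (indicator {0..} y *\<^sub>R (exp (- y\<^sup>2) * y)))"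
      using gaussian_moment_1 by (intro integrable_mult_right) (simp add: has_bochner_integral_iff)
    then show ?thesis by (simp add: mult_ac)
  qed
  \<comment> \<open>As x + y >= 0, the distribution function lies between 0 and 1, so the Rayleigh
    density dominates.\<close>
  have w_int: "integrable lborel (\<lambda>y. indicator {0..} y * ?w y)"
  proof (rule Bochner_Integration.integrable_bound[OF base])
    show "(\<lambda>y. indicator {0..} y * ?w y) \<in> borel_measurable lborel"
      unfolding rayleigh_sum_cdf_def by measurable
    show "AE y in lborel. norm (indicator {0..} y * ?w y) \<le> norm (indicator {0..} y * (2 * y * exp (- y\<^sup>2)))"
    proof (intro AE_I2)
      fix y :: real
      show "norm (indicator {0..} y * ?w y) \<le> norm (indicator {0..} y * (2 * y * exp (- y\<^sup>2)))"
      proof (cases "0 \<le> y")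
        case True
        then have "\<bar>rayleigh_sum_cdf (x + y)\<bar> \<le> 1"
          using x rayleigh_sum_cdf_nonneg[of "x + y"] rayleigh_sum_cdf_le_1[of "x + y"] by simp
        then have "\<bar>2 * y * exp (- y\<^sup>2)\<bar> * \<bar>rayleigh_sum_cdf (x + y)\<bar> \<le> \<bar>2 * y * exp (- y\<^sup>2)\<bar>"
          by (intro mult_left_le) auto
        then show ?thesis using True by (simp only: abs_mult real_norm_def) simp
      qed simp
    qed
  qed
  have L_int: "integrable lborel (\<lambda>y. indicator {0..} y * ?L y)"
  proof -
    have "integrable lborel (\<lambda>y. indicator {0..} y * ?w y + c * (indicator {0..} y * ?k y))"
      using k by (intro Bochner_Integration.integrable_add integrable_mult_right w_int)
         (auto simp: has_bochner_integral_iff)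
    then show ?thesis by (simp add: algebra_simps)
  qed
  \<comment> \<open>For large x the constant \<open>c\<close> is negative and \<open>?L\<close> is
    not visibly nonnegative; hence the version of the fundamental theorem that asks for
    integrability instead.\<close>
  have "(LBINT y=ereal 0..\<infinity>. ?L y) = 0 - ?D 0"
  proof (rule interval_integral_FTC_integrable[where F="?D"])
    show "(?D has_vector_derivative ?L y) (at y)" for y
      using D has_real_derivative_iff_has_vector_derivative by blast
    show "isCont ?L y" for y
      unfolding rayleigh_sum_cdf_def
      by (intro continuous_intros isCont_o2[OF _ isCont_gauss_tail]) auto
    have "set_integrable lborel {0..} ?L" using L_int by (simp add: set_integrable_def)
    then show "set_integrable lborel (einterval (ereal 0) \<infinity>) ?L"
      by (rule set_integrable_subset) (auto simp: einterval_def)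
    have "(?D \<longlongrightarrow> ?D 0) (at_right 0)"
      using DERIV_isCont[OF D[of 0]] unfolding isCont_def
      by (rule filterlim_mono[OF _ order_refl at_le]) simp
    then show "((?D \<circ> real_of_ereal) \<longlongrightarrow> ?D 0) (at_right (ereal 0))"
      by (simp only: ereal_tendsto_simps)
    show "((?D \<circ> real_of_ereal) \<longlongrightarrow> 0) (at_left \<infinity>)"
      using Dlim by (simp only: ereal_tendsto_simps)
  qed simp
  also have "(LBINT y=ereal 0..\<infinity>. ?L y) = (LBINT y:{0..}. ?L y)"
    unfolding interval_integral_to_infinity_eq
    by (intro set_integral_discrete_difference[where X="{0}"]) auto
  finally have L: "has_bochner_integral lborel (\<lambda>y. indicator {0..} y * ?L y) (- ?D 0)"
    using L_int by (simp add: has_bochner_integral_iff set_lebesgue_integral_def)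
  have "has_bochner_integral lborel (\<lambda>y. indicator {0..} y * ?L y - c * (indicator {0..} y * ?k y))
    (- ?D 0 - c * (exp (- (x\<^sup>2 / 3)) / sqrt 3 * phi_fun 1 x))"
    by (intro has_bochner_integral_diff has_bochner_integral_mult_right L k)
  also have "(\<lambda>y. indicator {0..} y * ?L y - c * (indicator {0..} y * ?k y)) = (\<lambda>y. indicator {0..} y * ?w y)"
    by (simp add: algebra_simps)
  also have "- ?D 0 - c * (exp (- (x\<^sup>2 / 3)) / sqrt 3 * phi_fun 1 x) = h_fun 1 x"
  proof -
    \<comment> \<open>Every square root in \<open>h_fun 1 x\<close> that involves pi becomes
      rational in \<open>s\<close> and sqrt 3 once pi is written as 2 * s^2.\<close>
    have "s > 0" and pi: "pi = 2 * s\<^sup>2" by (simp_all add: s_def power_divide)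
    have r: "sqrt (pi / 2) = s" "sqrt (1 / (2 * pi)) = 1 / (2 * s)" "sqrt (2 / (3 * pi)) = 1 / (s * sqrt 3)"
      using \<open>s > 0\<close> unfolding pi by (simp_all add: real_sqrt_divide real_sqrt_mult)
    have "h_fun 1 x = 1 / 2 - 1 / 2 * (1 / 2 * exp (- x\<^sup>2) - x * exp (- (x\<^sup>2 / 2)) * s * (gauss_tail x / (2 * s)))
      + s * (1 / (2 * s) - 4 * x / 9 * exp (- (x\<^sup>2 / 2))
        + 23 * x / 18 * exp (- (x\<^sup>2 / 2)) * (gauss_tail x / (2 * s))
        - 5 / 6 * (1 / (2 * s)) * exp (- x\<^sup>2)
        + 1 / (s * sqrt 3) * (4 * x\<^sup>2 / 9 - 2 / 3) * exp (- (x\<^sup>2 / 3)) * phi_fun 1 x)"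
    proof -
      have "gauss_Q x = gauss_tail x / (2 * s)" by (simp add: gauss_Q_eq_tail s_def)
      then show ?thesis by (simp only: h_fun_def I_fun_def J_fun_def r div_by_1 mult_1_right real_sqrt_one)
    qed
    \<comment> \<open>Collecting terms explains the coefficients 5/6 and 23/18: with the 1/4 coming
      from \<open>I_fun\<close>, 5/12 + 1/4 = 2/3 and 23/36 + 1/4 = 8/9.\<close>
    also have "\<dots> = 1 - 2 / 3 * exp (- x\<^sup>2) - 4 * x / 9 * exp (- (x\<^sup>2 / 2)) * (s - 2 * gauss_tail x)
        - (2 / 3 - 4 * x\<^sup>2 / 9) * (exp (- (x\<^sup>2 / 3)) / sqrt 3 * phi_fun 1 x)"
      using \<open>s > 0\<close> by (simp add: field_simps)
    finally show ?thesis
      by (simp add: c_def field_simps)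
  qed
  finally show ?thesis .
qed

section \<open>Scaling\<close>

lemma rayleigh_density_scale:
  assumes "0 < \<sigma>"
  shows "sqrt \<sigma> * rayleigh_density \<sigma> (sqrt \<sigma> * u) = rayleigh_density 1 u"
proof -
  define r where "r = sqrt \<sigma>"
  have "0 < r" "\<sigma> = r\<^sup>2" using assms by (auto simp: r_def)
  then show ?thesis
    by (simp add: rayleigh_density_def power_mult_distrib zero_le_mult_iff power2_eq_square)
qed

lemma nn_integral_rayleigh_scale:
  assumes \<sigma>: "0 < \<sigma>" and [measurable]: "g \<in> borel_measurable borel"
  shows "(\<integral>\<^sup>+y. ennreal (rayleigh_density \<sigma> y) * g y \<partial>lborel)
    = (\<integral>\<^sup>+u. ennreal (rayleigh_density 1 u) * g (sqrt \<sigma> * u) \<partial>lborel)"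
proof -
  have "(\<integral>\<^sup>+y. ennreal (rayleigh_density \<sigma> y) * g y \<partial>lborel)
    = ennreal (sqrt \<sigma>) * (\<integral>\<^sup>+u. ennreal (rayleigh_density \<sigma> (sqrt \<sigma> * u)) * g (sqrt \<sigma> * u) \<partial>lborel)"
    using \<sigma> by (subst nn_integral_real_affine[where c="sqrt \<sigma>" and t=0]) auto
  also have "\<dots> = (\<integral>\<^sup>+u. ennreal (sqrt \<sigma> * rayleigh_density \<sigma> (sqrt \<sigma> * u)) * g (sqrt \<sigma> * u) \<partial>lborel)"
    using \<sigma> by (subst nn_integral_cmult[symmetric])
      (auto simp: ennreal_mult rayleigh_density_nonneg mult.assoc)
  finally show ?thesis using \<sigma> by (simp add: rayleigh_density_scale)
qed

text \<open>The set itself varies with the integration point, as it does in the inner integrals of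
  \<open>win_prob\<close>; the next lemma does the same for ties.\<close>

lemma borel_measurable_indicator_lessThan [measurable]:
  fixes f g :: "'b \<Rightarrow> real"
  assumes [measurable]: "f \<in> borel_measurable M" "g \<in> borel_measurable M"
  shows "(\<lambda>x. indicator {..<f x} (g x) :: ennreal) \<in> borel_measurable M"
proof -
  have "(\<lambda>x. indicator {..<f x} (g x) :: ennreal) = (\<lambda>x. if g x < f x then 1 else 0)"
    by (auto simp: indicator_def)
  then show ?thesis by simp
qed

lemma borel_measurable_indicator_singleton [measurable]:
  fixes f g :: "'b \<Rightarrow> real"
  assumes [measurable]: "f \<in> borel_measurable M" "g \<in> borel_measurable M"
  shows "(\<lambda>x. indicator {f x} (g x) :: ennreal) \<in> borel_measurable M"
proof -
  have "(\<lambda>x. indicator {f x} (g x) :: ennreal) = (\<lambda>x. if g x = f x then 1 else 0)"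
    by (auto simp: indicator_def)
  then show ?thesis by simp
qed

text \<open>The probability P(a + b < x + y) that a pair with first addend x beats the other pair,
  as an iterated integral. With y outermost, the two inner integrals form the distribution function
  of the sum at x + y.\<close>

definition win_prob :: "real \<Rightarrow> real \<Rightarrow> ennreal" where
  "win_prob \<sigma> x = (\<integral>\<^sup>+y. ennreal (rayleigh_density \<sigma> y)
    * (\<integral>\<^sup>+a. ennreal (rayleigh_density \<sigma> a)
      * (\<integral>\<^sup>+b. ennreal (rayleigh_density \<sigma> b) * indicator {..<x + y - a} b \<partial>lborel) \<partial>lborel) \<partial>lborel)"

lemma win_prob_measurable [measurable]: "win_prob \<sigma> \<in> borel_measurable borel"
  unfolding win_prob_def by measurable

text \<open>The winning condition is homogeneous of degree one, so rescaling all variables by sqrt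
  \<sigma> leaves it unchanged.\<close>

lemma win_prob_scale:
  assumes \<sigma>: "0 < \<sigma>"
  shows "win_prob \<sigma> (sqrt \<sigma> * t) = win_prob 1 t"
proof -
  have i: "indicator {..<sqrt \<sigma> * t + sqrt \<sigma> * u - sqrt \<sigma> * v} (sqrt \<sigma> * w)
      = (indicator {..<t + u - v} w :: ennreal)" for u v w
  proof -
    have "sqrt \<sigma> * w < sqrt \<sigma> * t + sqrt \<sigma> * u - sqrt \<sigma> * v \<longleftrightarrow> sqrt \<sigma> * w < sqrt \<sigma> * (t + u - v)"
      by (simp add: algebra_simps)
    also have "\<dots> \<longleftrightarrow> w < t + u - v" using \<sigma> by simp
    finally show ?thesis by (simp add: indicator_def)
  qed
  show ?thesis
    unfolding win_prob_def by (simp add: nn_integral_rayleigh_scale[OF \<sigma>] i)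
qed

lemma
  assumes x: "0 \<le> x"
  shows win_prob_1: "win_prob 1 x = ennreal (h_fun 1 x)"
    and h_fun_1_nonneg: "0 \<le> h_fun 1 x"
proof -
  let ?g = "\<lambda>y. indicator {0..} y * (2 * y * exp (- y\<^sup>2) * rayleigh_sum_cdf (x + y))"
  note b = has_bochner_integral_rayleigh_weighted_cdf[OF x]
  have nn: "0 \<le> ?g y" for y
    using x rayleigh_sum_cdf_nonneg[of "x + y"] by (auto split: split_indicator)
  have h: "h_fun 1 x = (\<integral>y. ?g y \<partial>lborel)"
    using b by (simp add: has_bochner_integral_iff)
  show "0 \<le> h_fun 1 x"
    unfolding h using nn by (intro Bochner_Integration.integral_nonneg)
  have "win_prob 1 x = (\<integral>\<^sup>+y. ennreal (?g y) \<partial>lborel)"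
    unfolding win_prob_def
  proof (intro nn_integral_cong)
    fix y :: real
    show "ennreal (rayleigh_density 1 y) * (\<integral>\<^sup>+a. ennreal (rayleigh_density 1 a)
      * (\<integral>\<^sup>+b. ennreal (rayleigh_density 1 b) * indicator {..<x + y - a} b \<partial>lborel) \<partial>lborel)
      = ennreal (?g y)"
    proof (cases "0 \<le> y")
      case True
      then show ?thesis
        using x rayleigh_sum_cdf_nonneg[of "x + y"]
        by (subst nn_integral_rayleigh_sum) (auto simp: rayleigh_density_def ennreal_mult)
    qed (simp add: rayleigh_density_def)
  qed
  also have "\<dots> = ennreal (h_fun 1 x)"
    unfolding h using b nn by (intro nn_integral_eq_integral) (auto simp: has_bochner_integral_iff)
  finally show "win_prob 1 x = ennreal (h_fun 1 x)" .
qed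

text \<open>\<open>I_fun\<close> and \<open>phi_fun\<close> depend on x / sqrt \<sigma> alone;
  \<open>J_fun\<close> carries one extra factor sqrt \<sigma>, cancelled by its prefactor in
  \<open>h_fun\<close>.\<close>

lemma h_fun_scale:
  assumes \<sigma>: "0 < \<sigma>"
  shows "h_fun \<sigma> (sqrt \<sigma> * t) = h_fun 1 t"
proof -
  have I: "I_fun \<sigma> (sqrt \<sigma> * t) = I_fun 1 t"
    using \<sigma> by (simp add: I_fun_def power_mult_distrib real_sqrt_divide real_sqrt_mult field_simps)
  have P: "phi_fun \<sigma> (sqrt \<sigma> * t) = phi_fun 1 t"
    using \<sigma> by (simp add: phi_fun_def power_mult_distrib real_sqrt_mult mult.assoc)
  have J: "sqrt (pi / (2 * \<sigma>)) * J_fun \<sigma> (sqrt \<sigma> * t) = sqrt (pi / 2) * J_fun 1 t"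
  proof -
    have "J_fun \<sigma> (sqrt \<sigma> * t) = sqrt \<sigma> * J_fun 1 t"
      using \<sigma> unfolding J_fun_def P
      by (simp add: power_mult_distrib real_sqrt_mult real_sqrt_divide algebra_simps)
    then show ?thesis using \<sigma> by (simp add: real_sqrt_divide real_sqrt_mult)
  qed
  show ?thesis unfolding h_fun_def I J by simp
qed

lemma
  assumes \<sigma>: "0 < \<sigma>" and x: "0 \<le> x"
  shows win_prob_eq_h_fun: "win_prob \<sigma> x = ennreal (h_fun \<sigma> x)"
    and h_fun_nonneg: "0 \<le> h_fun \<sigma> x"
proof -
  define t where "t = x / sqrt \<sigma>"
  have t: "0 \<le> t" "x = sqrt \<sigma> * t" using \<sigma> x by (auto simp: t_def)
  show "win_prob \<sigma> x = ennreal (h_fun \<sigma> x)" "0 \<le> h_fun \<sigma> x"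
    unfolding t(2) win_prob_scale[OF \<sigma>] h_fun_scale[OF \<sigma>]
    using win_prob_1[OF t(1)] h_fun_1_nonneg[OF t(1)] by auto
qed

lemma first_addend_density_nonneg: "0 < \<sigma> \<Longrightarrow> 0 \<le> first_addend_density \<sigma> x"
  using h_fun_nonneg[of \<sigma> x] by (simp add: first_addend_density_def)

lemma first_addend_density_eq:
  assumes "0 < \<sigma>"
  shows "ennreal (first_addend_density \<sigma> x) = 2 * (ennreal (rayleigh_density \<sigma> x) * win_prob \<sigma> x)"
proof (cases "0 \<le> x")
  case True
  have "first_addend_density \<sigma> x = 2 * (rayleigh_density \<sigma> x * h_fun \<sigma> x)"
    using True by (simp add: first_addend_density_def rayleigh_density_def)
  then show ?thesis
    using True assms
    by (simp add: win_prob_eq_h_fun ennreal_mult rayleigh_density_nonneg h_fun_nonneg)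
qed (simp add: first_addend_density_def rayleigh_density_def)

section \<open>The winning pair\<close>

lemma (in prob_space) indep_var_singletons:
  assumes ind: "indep_vars (\<lambda>_. borel) X I" and ij: "i \<in> I" "j \<in> I" "i \<noteq> j"
  shows "indep_var borel (X i) borel (X j)"
proof -
  have "indep_var borel ((\<lambda>g. g i) \<circ> (\<lambda>\<omega>. \<lambda>k\<in>{i}. X k \<omega>)) borel ((\<lambda>g. g j) \<circ> (\<lambda>\<omega>. \<lambda>k\<in>{j}. X k \<omega>))"
    using ij by (intro indep_var_compose[OF indep_var_restrict[OF ind]]) auto
  then show ?thesis by (simp add: o_def)
qed

lemma (in prob_space) indep_var_pairs:
  fixes X :: "'i \<Rightarrow> 'a \<Rightarrow> real"
  assumes ind: "indep_vars (\<lambda>_. borel) X I" and I: "{i, j} \<subseteq> I" "{k, l} \<subseteq> I" "{i, j} \<inter> {k, l} = {}"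
  shows "indep_var (borel \<Otimes>\<^sub>M borel) (\<lambda>\<omega>. (X i \<omega>, X j \<omega>)) (borel \<Otimes>\<^sub>M borel) (\<lambda>\<omega>. (X k \<omega>, X l \<omega>))"
proof -
  have "indep_var (borel \<Otimes>\<^sub>M borel) ((\<lambda>g. (g i, g j)) \<circ> (\<lambda>\<omega>. \<lambda>m\<in>{i, j}. X m \<omega>))
      (borel \<Otimes>\<^sub>M borel) ((\<lambda>g. (g k, g l)) \<circ> (\<lambda>\<omega>. \<lambda>m\<in>{k, l}. X m \<omega>))"
    by (intro indep_var_compose[OF indep_var_restrict[OF ind I(3,1,2)]] measurable_Pair
        measurable_component_singleton) auto
  then show ?thesis by (simp add: o_def)
qed

text \<open>Independence sees only the sigma-algebras of the targets; this allows passing from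
  \<open>borel\<close> and its products to \<open>lborel\<close>, over which densities are
  stated.\<close>

lemma indep_var_cong_sets:
  assumes "prob_space M" "prob_space.indep_var M S X T Y" "sets S = sets S'" "sets T = sets T'"
  shows "prob_space.indep_var M S' X T' Y"
proof -
  interpret prob_space M by fact
  have "indep_var S' ((\<lambda>x. x) \<circ> X) T' ((\<lambda>x. x) \<circ> Y)"
    using assms(2-4) by (intro indep_var_compose[of S X T Y]) (auto intro: measurable_ident_sets)
  then show ?thesis by (simp add: o_def)
qed

lemma nn_integral_lborel_pair:
  fixes H :: "'a::euclidean_space \<times> 'b::euclidean_space \<Rightarrow> ennreal"
  assumes "H \<in> borel_measurable borel"
  shows "(\<integral>\<^sup>+p. H p \<partial>lborel) = (\<integral>\<^sup>+x. \<integral>\<^sup>+y. H (x, y) \<partial>lborel \<partial>lborel)"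
proof -
  have "H \<in> borel_measurable (lborel \<Otimes>\<^sub>M lborel)"
    using assms by (simp add: lborel_prod)
  then show ?thesis
    by (subst lborel_prod[symmetric], subst lborel.nn_integral_fst[symmetric]) auto
qed

text \<open>Independence is used twice: inside each pair, for its product density, and between the
  two pairs. Tonelli then unfolds the nested pairs.\<close>

lemma (in prob_space) nn_integral_indep_quadruple:
  fixes X :: "'i \<Rightarrow> 'a \<Rightarrow> real"
  assumes ind: "indep_vars (\<lambda>_. borel) X I"
    and I: "{i, j, k, l} \<subseteq> I" "distinct [i, j, k, l]"
    and dist: "\<And>m. m \<in> I \<Longrightarrow> distributed M lborel (X m) f"
    and g: "(\<lambda>z. g (fst (fst z)) (snd (fst z)) (fst (snd z)) (snd (snd z))) \<in> borel_measurable borel"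
  shows "(\<integral>\<^sup>+\<omega>. g (X i \<omega>) (X j \<omega>) (X k \<omega>) (X l \<omega>) \<partial>M)
    = (\<integral>\<^sup>+x. \<integral>\<^sup>+y. \<integral>\<^sup>+a. \<integral>\<^sup>+b. f x * f y * (f a * f b) * g x y a b \<partial>lborel \<partial>lborel \<partial>lborel \<partial>lborel)"
proof -
  have f [measurable]: "f \<in> borel_measurable borel"
    using dist[of i] I by (auto dest: distributed_borel_measurable)
  have pair: "distributed M lborel (\<lambda>\<omega>. (X m \<omega>, X n \<omega>)) (\<lambda>(x, y). f x * f y)"
    if "m \<in> I" "n \<in> I" "m \<noteq> n" for m n
  proof -
    have "indep_var lborel (X m) lborel (X n)"
      using indep_var_singletons[OF ind that] by (rule indep_var_cong_sets[OF prob_space_axioms]) auto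
    then show ?thesis
      using distributed_joint_indep[OF lborel.sigma_finite_measure_axioms lborel.sigma_finite_measure_axioms
        dist[OF that(1)] dist[OF that(2)]] by (simp add: lborel_prod)
  qed
  have s: "sets (borel \<Otimes>\<^sub>M borel :: (real \<times> real) measure) = sets lborel"
    unfolding borel_prod by simp
  have "indep_var lborel (\<lambda>\<omega>. (X i \<omega>, X j \<omega>)) lborel (\<lambda>\<omega>. (X k \<omega>, X l \<omega>))"
    by (rule indep_var_cong_sets[OF prob_space_axioms indep_var_pairs[OF ind] s s]) (use I in auto)
  then have "distributed M (lborel \<Otimes>\<^sub>M lborel) (\<lambda>\<omega>. ((X i \<omega>, X j \<omega>), (X k \<omega>, X l \<omega>)))
      (\<lambda>(p, q). (\<lambda>(x, y). f x * f y) p * (\<lambda>(x, y). f x * f y) q)"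
    by (intro distributed_joint_indep lborel.sigma_finite_measure_axioms pair) (use I in auto)
  then have D: "distributed M lborel (\<lambda>\<omega>. ((X i \<omega>, X j \<omega>), (X k \<omega>, X l \<omega>)))
      (\<lambda>z. f (fst (fst z)) * f (snd (fst z)) * (f (fst (snd z)) * f (snd (snd z))))"
    by (simp add: case_prod_beta' lborel_prod)
  define H where "H z = f (fst (fst z)) * f (snd (fst z)) * (f (fst (snd z)) * f (snd (snd z)))
    * g (fst (fst z)) (snd (fst z)) (fst (snd z)) (snd (snd z))" for z
  have H [measurable]: "H \<in> borel_measurable borel"
  proof -
    \<comment> \<open>Measurability is decomposed along product sigma-algebras, so the Borel sets of
      the product type are first rewritten as such.\<close>
    note [measurable] = g[folded borel_prod]
    show ?thesis unfolding H_def borel_prod[symmetric] by measurable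
  qed
  have "(\<integral>\<^sup>+\<omega>. g (X i \<omega>) (X j \<omega>) (X k \<omega>) (X l \<omega>) \<partial>M) = (\<integral>\<^sup>+z. H z \<partial>lborel)"
    unfolding H_def using g by (subst distributed_nn_integral[OF D]) simp_all
  also have "\<dots> = (\<integral>\<^sup>+x. \<integral>\<^sup>+y. \<integral>\<^sup>+a. \<integral>\<^sup>+b. H ((x, y), (a, b)) \<partial>lborel \<partial>lborel \<partial>lborel \<partial>lborel)"
  proof -
    have "(\<integral>\<^sup>+z. H z \<partial>lborel) = (\<integral>\<^sup>+p. \<integral>\<^sup>+q. H (p, q) \<partial>lborel \<partial>lborel)"
      by (rule nn_integral_lborel_pair[OF H])
    also have "\<dots> = (\<integral>\<^sup>+x. \<integral>\<^sup>+y. \<integral>\<^sup>+q. H ((x, y), q) \<partial>lborel \<partial>lborel \<partial>lborel)"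
      by (rule nn_integral_lborel_pair) measurable
    also have "\<dots> = (\<integral>\<^sup>+x. \<integral>\<^sup>+y. \<integral>\<^sup>+a. \<integral>\<^sup>+b. H ((x, y), (a, b)) \<partial>lborel \<partial>lborel \<partial>lborel \<partial>lborel)"
      by (intro nn_integral_cong nn_integral_lborel_pair) measurable
    finally show ?thesis .
  qed
  also have "\<dots> = (\<integral>\<^sup>+x. \<integral>\<^sup>+y. \<integral>\<^sup>+a. \<integral>\<^sup>+b. f x * f y * (f a * f b) * g x y a b \<partial>lborel \<partial>lborel \<partial>lborel \<partial>lborel)"
    by (simp add: H_def)
  finally show ?thesis .
qed

theorem mainTheorem8:
  fixes M :: "'a measure" and \<sigma> :: real
    and X :: "nat \<Rightarrow> nat \<Rightarrow> 'a \<Rightarrow> real" and J :: "'a \<Rightarrow> nat"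
  assumes "prob_space M"
    and "\<sigma> > 0"
    and "prob_space.indep_vars M (\<lambda>_. borel) (\<lambda>(j, k). X j k) ({1, 2} \<times> {1, 2})"
    and "\<And>j k. j \<in> {1, 2} \<Longrightarrow> k \<in> {1, 2} \<Longrightarrow>
           distributed M lborel (X j k) (\<lambda>x. ennreal (rayleigh_density \<sigma> x))"
    and "J \<in> measurable M (count_space {1, 2})"
    and "AE \<omega> in M. is_arg_max (\<lambda>j. X j 1 \<omega> + X j 2 \<omega>) (\<lambda>j. j \<in> {1, 2}) (J \<omega>)"
  shows "(\<forall>x. 0 \<le> first_addend_density \<sigma> x) \<and>
         distributed M lborel (\<lambda>\<omega>. X (J \<omega>) 1 \<omega>)
           (\<lambda>x. ennreal (first_addend_density \<sigma> x))"
proof (intro conjI allI)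
  show "0 \<le> first_addend_density \<sigma> x" for x
    using \<open>\<sigma> > 0\<close> by (rule first_addend_density_nonneg)
  interpret prob_space M by fact
  note \<sigma> = \<open>\<sigma> > 0\<close>
  let ?f = "\<lambda>x. ennreal (rayleigh_density \<sigma> x)"
  have meas [measurable]: "X j k \<in> borel_measurable M" if "j \<in> {1, 2}" "k \<in> {1, 2}" for j k
    using assms(4)[OF that] by (auto dest: distributed_measurable)
  have m: "X 1 1 \<in> borel_measurable M" "X 2 1 \<in> borel_measurable M"
      "X 1 2 \<in> borel_measurable M" "X 2 2 \<in> borel_measurable M"
    by (auto intro: meas)
  note [measurable] = m
  \<comment> \<open>Both orders of the two pairs are covered, because each pair serves once as the
    winner.\<close>
  have quad: "(\<integral>\<^sup>+\<omega>. g (X i 1 \<omega>) (X i 2 \<omega>) (X j 1 \<omega>) (X j 2 \<omega>) \<partial>M)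
    = (\<integral>\<^sup>+x. \<integral>\<^sup>+y. \<integral>\<^sup>+a. \<integral>\<^sup>+b. ?f x * ?f y * (?f a * ?f b) * g x y a b \<partial>lborel \<partial>lborel \<partial>lborel \<partial>lborel)"
    if "{i, j} = {1, 2}" "(\<lambda>z. g (fst (fst z)) (snd (fst z)) (fst (snd z)) (snd (snd z))) \<in> borel_measurable borel"
    for i j and g :: "real \<Rightarrow> real \<Rightarrow> real \<Rightarrow> real \<Rightarrow> ennreal"
  proof -
    have "distributed M lborel ((\<lambda>(j, k). X j k) p) ?f" if "p \<in> {1, 2} \<times> {1, 2}" for p
      using that assms(4) by force
    moreover have "{(i, 1), (i, 2), (j, 1), (j, 2)} \<subseteq> {1, 2} \<times> {1, 2 :: nat}"
        "distinct [(i, 1), (i, 2 :: nat), (j, 1), (j, 2)]"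
      using that(1) by (auto simp: doubleton_eq_iff)
    ultimately show ?thesis
      using nn_integral_indep_quadruple[OF assms(3), of "(i, 1)" "(i, 2)" "(j, 1)" "(j, 2)" ?f g] that(2)
      by (simp only: prod.case)
  qed
  have win: "(\<integral>\<^sup>+\<omega>. indicator A (X i 1 \<omega>) * indicator {..<X i 1 \<omega> + X i 2 \<omega> - X j 1 \<omega>} (X j 2 \<omega>) \<partial>M)
      = (\<integral>\<^sup>+x. ?f x * win_prob \<sigma> x * indicator A x \<partial>lborel)"
    if ij: "{i, j} = {1, 2}" and [measurable]: "A \<in> sets borel" for i j A
  proof -
    have "(\<integral>\<^sup>+\<omega>. indicator A (X i 1 \<omega>) * indicator {..<X i 1 \<omega> + X i 2 \<omega> - X j 1 \<omega>} (X j 2 \<omega>) \<partial>M)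
      = (\<integral>\<^sup>+x. \<integral>\<^sup>+y. \<integral>\<^sup>+a. \<integral>\<^sup>+b. ?f x * ?f y * (?f a * ?f b)
          * (indicator A x * indicator {..<x + y - a} b) \<partial>lborel \<partial>lborel \<partial>lborel \<partial>lborel)"
      by (rule quad[OF ij, of "\<lambda>x y a b. indicator A x * indicator {..<x + y - a} b"])
         (simp add: borel_prod[symmetric])
    also have "\<dots> = (\<integral>\<^sup>+x. \<integral>\<^sup>+y. \<integral>\<^sup>+a. \<integral>\<^sup>+b. (?f x * indicator A x) * (?f y * (?f a *
          (?f b * indicator {..<x + y - a} b))) \<partial>lborel \<partial>lborel \<partial>lborel \<partial>lborel)"
      by (simp only: mult_ac)
    also have "\<dots> = (\<integral>\<^sup>+x. (?f x * indicator A x) * win_prob \<sigma> x \<partial>lborel)"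
      unfolding win_prob_def by (simp add: nn_integral_cmult)
    finally show ?thesis by (simp only: mult_ac)
  qed
  have tie: "AE \<omega> in M. X 1 1 \<omega> + X 1 2 \<omega> \<noteq> X 2 1 \<omega> + X 2 2 \<omega>"
  proof -
    \<comment> \<open>With the other three variables fixed, a tie pins the fourth to a single
      point.\<close>
    have zero: "(\<integral>\<^sup>+b. ?f x * ?f y * (?f a * ?f b) * indicator {x + y - a} b \<partial>lborel) = 0" for x y a
    proof -
      have "AE b in lborel. b \<noteq> x + y - a" by (rule AE_lborel_singleton)
      then have "AE b in lborel. ?f x * ?f y * (?f a * ?f b) * indicator {x + y - a} b = 0"
        by eventually_elim simp
      then show ?thesis by (rule nn_integral_zero')
    qed
    have "(\<integral>\<^sup>+\<omega>. indicator {X 1 1 \<omega> + X 1 2 \<omega> - X 2 1 \<omega>} (X 2 2 \<omega>) \<partial>M)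
      = (\<integral>\<^sup>+x. \<integral>\<^sup>+y. \<integral>\<^sup>+a. \<integral>\<^sup>+b. ?f x * ?f y * (?f a * ?f b)
          * indicator {x + y - a} b \<partial>lborel \<partial>lborel \<partial>lborel \<partial>lborel)"
      by (rule quad[of 1 2 "\<lambda>x y a b. indicator {x + y - a} b"])
         (auto simp: borel_prod[symmetric])
    also have "\<dots> = 0" unfolding zero by simp
    finally have "(\<integral>\<^sup>+\<omega>. indicator {X 1 1 \<omega> + X 1 2 \<omega> - X 2 1 \<omega>} (X 2 2 \<omega>) \<partial>M) = 0" .
    then have "AE \<omega> in M. (indicator {X 1 1 \<omega> + X 1 2 \<omega> - X 2 1 \<omega>} (X 2 2 \<omega>) :: ennreal) = 0"
      by (subst (asm) nn_integral_0_iff_AE) auto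
    then show ?thesis
      by eventually_elim (auto split: split_indicator_asm)
  qed
  have J: "J \<omega> = 1 \<or> J \<omega> = 2" if "\<omega> \<in> space M" for \<omega>
    using measurable_space[OF assms(5) that] by simp
  have Y [measurable]: "(\<lambda>\<omega>. X (J \<omega>) 1 \<omega>) \<in> borel_measurable M"
  proof -
    have [measurable]: "J \<in> measurable M (count_space UNIV)"
      using assms(5) by (rule measurable_compose) auto
    \<comment> \<open>\<open>J\<close> takes only the values 1 and 2 on the whole space, so the
      random index reduces to one measurable case distinction.\<close>
    have "(\<lambda>\<omega>. if J \<omega> = 1 then X 1 1 \<omega> else X 2 1 \<omega>) \<in> borel_measurable M"
      by measurable
    also have "?this \<longleftrightarrow> ?thesis"
      using J by (intro measurable_cong) force
    finally show ?thesis .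
  qed
  have dens [measurable]: "(\<lambda>x. ennreal (first_addend_density \<sigma> x)) \<in> borel_measurable borel"
    unfolding first_addend_density_eq[OF \<sigma>] by measurable
  show "distributed M lborel (\<lambda>\<omega>. X (J \<omega>) 1 \<omega>) (\<lambda>x. ennreal (first_addend_density \<sigma> x))"
    unfolding distributed_def
  proof (intro conjI measure_eqI)
    fix A assume "A \<in> sets (distr M lborel (\<lambda>\<omega>. X (J \<omega>) 1 \<omega>))"
    then have A [measurable]: "A \<in> sets borel" by simp
    have "emeasure (distr M lborel (\<lambda>\<omega>. X (J \<omega>) 1 \<omega>)) A
        = (\<integral>\<^sup>+x. indicator A x \<partial>distr M lborel (\<lambda>\<omega>. X (J \<omega>) 1 \<omega>))"
      by (rule nn_integral_indicator[symmetric]) simp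
    also have "\<dots> = (\<integral>\<^sup>+\<omega>. indicator A (X (J \<omega>) 1 \<omega>) \<partial>M)"
      by (rule nn_integral_distr) (use Y in simp_all)
    \<comment> \<open>Without a tie \<open>J\<close> is the unique maximiser: the summand of the
      winning pair equals the indicator and the other one vanishes.\<close>
    also have "\<dots> = (\<integral>\<^sup>+\<omega>. indicator A (X 1 1 \<omega>) * indicator {..<X 1 1 \<omega> + X 1 2 \<omega> - X 2 1 \<omega>} (X 2 2 \<omega>)
        + indicator A (X 2 1 \<omega>) * indicator {..<X 2 1 \<omega> + X 2 2 \<omega> - X 1 1 \<omega>} (X 1 2 \<omega>) \<partial>M)"
    proof (rule nn_integral_cong_AE)
      show "AE \<omega> in M. indicator A (X (J \<omega>) 1 \<omega>)
        = indicator A (X 1 1 \<omega>) * indicator {..<X 1 1 \<omega> + X 1 2 \<omega> - X 2 1 \<omega>} (X 2 2 \<omega>)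
        + indicator A (X 2 1 \<omega>) * (indicator {..<X 2 1 \<omega> + X 2 2 \<omega> - X 1 1 \<omega>} (X 1 2 \<omega>) :: ennreal)"
        using tie assms(6)
      proof eventually_elim
        case (elim \<omega>)
        then have "J \<omega> = 1 \<and> X 2 1 \<omega> + X 2 2 \<omega> < X 1 1 \<omega> + X 1 2 \<omega>
          \<or> J \<omega> = 2 \<and> X 1 1 \<omega> + X 1 2 \<omega> < X 2 1 \<omega> + X 2 2 \<omega>"
          unfolding is_arg_max_linorder by force
        then show ?case by (auto split: split_indicator)
      qed
    qed
    also have "\<dots> = (\<integral>\<^sup>+\<omega>. indicator A (X 1 1 \<omega>) * indicator {..<X 1 1 \<omega> + X 1 2 \<omega> - X 2 1 \<omega>} (X 2 2 \<omega>) \<partial>M)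
        + (\<integral>\<^sup>+\<omega>. indicator A (X 2 1 \<omega>) * indicator {..<X 2 1 \<omega> + X 2 2 \<omega> - X 1 1 \<omega>} (X 1 2 \<omega>) \<partial>M)"
      by (subst nn_integral_add) auto
    \<comment> \<open>The value given by \<open>win\<close> does not depend on which pair wins; this
      is the factor 2 of the density.\<close>
    also have "\<dots> = 2 * (\<integral>\<^sup>+x. ?f x * win_prob \<sigma> x * indicator A x \<partial>lborel)"
      using win[of 1 2, OF refl A] win[of 2 1, OF insert_commute A] by (simp only: mult_2)
    also have "\<dots> = (\<integral>\<^sup>+x. ennreal (first_addend_density \<sigma> x) * indicator A x \<partial>lborel)"
      unfolding first_addend_density_eq[OF \<sigma>]
      by (subst nn_integral_cmult[symmetric]) (auto simp: mult.assoc)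
    also have "\<dots> = emeasure (density lborel (\<lambda>x. ennreal (first_addend_density \<sigma> x))) A"
      by (simp add: emeasure_density)
    finally show "emeasure (distr M lborel (\<lambda>\<omega>. X (J \<omega>) 1 \<omega>)) A
      = emeasure (density lborel (\<lambda>x. ennreal (first_addend_density \<sigma> x))) A" .
  qed (use Y dens in simp_all)
qed

end
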